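(* Let $p\geq 1$ and $q\geq 1$ be integers. The group $$G=\{(x,y,z)\mapsto\lambda\,(A(x,y)+(x_0,y_0),z) : \lambda>0,\ A\in\mathrm O(p-1,q),\ (x_0,y_0)\in\mathbb R^{p-1}\oplus\mathbb R^q\}$$ coincides with the isometry group $\mathrm{Isom}(\mathcal H^{p,q})$. Moreover, $G$ corresponds precisely (via the monomorphism $G\to\mathrm{Isom}(\mathbb H^{p,q})$ induced by $\iota_{p,q}$) to the isometries in $\mathrm{Isom}(\mathbb H^{p,q})$ that preserve the totally geodesic degenerate hyperplane $\mathbb H^{p,q}\setminus\iota_{p,q}(\mathcal H^{p,q})$.
   Context: The half-space model is $\mathcal H^{p,q}=\{(x,y,z)\in\mathbb R^{p-1}\oplus\mathbb R^q\oplus\mathbb R:z>0\}$ with the pseudo-Riemannian metric $\frac{dx_1^2+\dots+dx_{p-1}^2-dy_1^2-\dots-dy_q^2+dz^2}{z^2}$. $\mathrm O(p-1,q)$ is the group of linear isometries of the form $\|x\|^2-\|y\|^2$ on $\mathbb R^{p-1}\oplus\mathbb R^q$. $\mathbb R^{p,q+1}$ is $\mathbb R^{p+q+1}$ with the form $\langle X,Y\rangle=\sum_{i\le p}X_iY_i-\sum_{i=p+1}^{p+q+1}X_iY_i$, and $\mathbb H^{p,q}=\{X\in\mathbb R^{p,q+1}:\langle X,X\rangle=-1\}/\{\pm\mathrm{Id}\}$ with the induced pseudo-Riemannian metric. The isometric embedding $\iota_{p,q}\colon\mathcal H^{p,q}\to\mathbb H^{p,q}$ is $$\iota_{p,q}(x,y,z)=\left[\frac{x}{z}:\frac{1-h(x,y)-z^2}{2z}:\frac{y}{z}:\frac{1+h(x,y)+z^2}{2z}\right],\quad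 h(x,y)=\|x\|^2-\|y\|^2$$ (entries in order: coordinates $1,\dots,p-1$; $p$; $p+1,\dots,p+q$; $p+q+1$); the complement of its image is $\{[X]\in\mathbb H^{p,q}:X_p+X_{p+q+1}=0\}$. Every isometry between connected open subsets of $\mathbb H^{p,q}$ extends uniquely to a global isometry of $\mathbb H^{p,q}$; hence each isometry $g$ of $\mathcal H^{p,q}$ induces a unique $\hat g\in\mathrm{Isom}(\mathbb H^{p,q})$ with $\hat g\circ\iota_{p,q}=\iota_{p,q}\circ g$, and $g\mapsto\hat g$ is the induced monomorphism. *)

theory Defs
  imports "HOL-Analysis.Analysis" "HOL-Algebra.Bij"
begin

text \<open>
  The space of the pairs (x,y), of dimension (p-1)+q, is \<open>real^'n\<close> together with the set
  \<open>J\<close> of the indices of the y-coordinates, so that \<open>card J = q\<close> and \<open>card (- J) = p - 1\<close>.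
  (Since p - 1 may be 0, the x-coordinates cannot be indexed by a type of their own.)
  The half-space lies in the type of triples (x,y,z); a vector of
  \<open>\<real>\<^sup>p\<^sup>,\<^sup>q\<^sup>+\<^sup>1\<close> is listed as ((x,y), a, b), where a is its p-th and b its (p+q+1)-st coordinate.
\<close>

type_synonym 'n half = "(real^'n) \<times> real"
type_synonym 'n amb = "(real^'n) \<times> real \<times> real"

definition hform :: "'n::finite set \<Rightarrow> real^'n \<Rightarrow> real^'n \<Rightarrow> real" where
  "hform J v w = (\<Sum>i\<in>-J. v $ i * w $ i) - (\<Sum>i\<in>J. v $ i * w $ i)"

abbreviation h :: "'n::finite set \<Rightarrow> real^'n \<Rightarrow> real" where
  "h J v \<equiv> hform J v v"

definition O_group :: "'n::finite set \<Rightarrow> (real^'n \<Rightarrow> real^'n) set" where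
  "O_group J = {A. linear A \<and> (\<forall>v. h J (A v) = h J v)}"


text \<open>Smoothness on an open set \<open>S\<close>: all iterated directional derivatives exist and are
  continuous.\<close>

primrec Ck_on :: "nat \<Rightarrow> 'a::euclidean_space set \<Rightarrow> ('a \<Rightarrow> 'b::euclidean_space) \<Rightarrow> bool" where
  "Ck_on 0 S f \<longleftrightarrow> continuous_on S f"
| "Ck_on (Suc k) S f \<longleftrightarrow> (\<forall>x\<in>S. f differentiable (at x)) \<and>
     (\<forall>v. Ck_on k S (\<lambda>x. frechet_derivative f (at x) v))"

definition smooth_on :: "'a::euclidean_space set \<Rightarrow> ('a \<Rightarrow> 'b::euclidean_space) \<Rightarrow> bool" where
  "smooth_on S f \<longleftrightarrow> (\<forall>k. Ck_on k S f)"


definition half_space :: "'n::finite half set" where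
  "half_space = {(v, z). z > 0}"

definition half_metric :: "'n::finite set \<Rightarrow> 'n half \<Rightarrow> 'n half \<Rightarrow> 'n half \<Rightarrow> real" where
  "half_metric J a u w = (hform J (fst u) (fst w) + snd u * snd w) / (snd a)\<^sup>2"

text \<open>Isometries are the diffeomorphisms preserving the metric tensor. As in \<^const>\<open>Bij\<close>,
  they are extensional, i.e. \<open>undefined\<close> outside of the space.\<close>

definition Isom_half :: "'n::finite set \<Rightarrow> ('n half \<Rightarrow> 'n half) set" where
  "Isom_half J = {g \<in> Bij half_space.
     smooth_on half_space g \<and> smooth_on half_space (inv_into half_space g) \<and>
     (\<forall>a\<in>half_space. \<forall>u w.
        half_metric J (g a) (frechet_derivative g (at a) u) (frechet_derivative g (at a) w)
        = half_metric J a u w)}"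

definition G_half :: "'n::finite set \<Rightarrow> ('n half \<Rightarrow> 'n half) set" where
  "G_half J = {restrict (\<lambda>(v, z). r *\<^sub>R (A v + v\<^sub>0, z)) half_space | r A v\<^sub>0.
     r > 0 \<and> A \<in> O_group J}"


definition aform :: "'n::finite set \<Rightarrow> 'n amb \<Rightarrow> 'n amb \<Rightarrow> real" where
  "aform J X Y = hform J (fst X) (fst Y) + fst (snd X) * fst (snd Y) - snd (snd X) * snd (snd Y)"

definition quadric :: "'n::finite set \<Rightarrow> 'n amb set" where
  "quadric J = {X. aform J X X = -1}"

text \<open>A point of the pseudo-hyperbolic space is the orbit \<open>{X, - X}\<close> of a point of the quadric.\<close>

definition cls :: "'n::finite amb \<Rightarrow> 'n amb set" where
  "cls X = {X, - X}"

definition HH :: "'n::finite set \<Rightarrow> 'n amb set set" where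
  "HH J = cls ` quadric J"

definition quadric_tangent :: "'n::finite set \<Rightarrow> 'n amb \<Rightarrow> 'n amb set" where
  "quadric_tangent J X = {u. aform J X u = 0}"

text \<open>The projection of the quadric onto \<open>HH J\<close> is a two-fold covering that defines the smooth
  structure and the metric of \<open>HH J\<close>. Hence a map of \<open>HH J\<close> is smooth iff near every point it
  lifts to a map of the quadric that is the restriction of a smooth map \<open>F\<close> of an open subset
  \<open>U\<close> of the ambient space, and the metric can be evaluated on such lifts.\<close>

definition is_lift ::
  "'n::finite set \<Rightarrow> ('n amb set \<Rightarrow> 'n amb set) \<Rightarrow> 'n amb set \<Rightarrow> ('n amb \<Rightarrow> 'n amb) \<Rightarrow> bool" where
  "is_lift J g U F \<longleftrightarrow> open U \<and> smooth_on U F \<and>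
     (\<forall>X\<in>U \<inter> quadric J. F X \<in> quadric J \<and> g (cls X) = cls (F X))"

definition smooth_HH :: "'n::finite set \<Rightarrow> ('n amb set \<Rightarrow> 'n amb set) \<Rightarrow> bool" where
  "smooth_HH J g \<longleftrightarrow> (\<forall>X\<in>quadric J. \<exists>U F. X \<in> U \<and> is_lift J g U F)"

definition preserves_metric_HH :: "'n::finite set \<Rightarrow> ('n amb set \<Rightarrow> 'n amb set) \<Rightarrow> bool" where
  "preserves_metric_HH J g \<longleftrightarrow> (\<forall>X\<in>quadric J. \<exists>U F. X \<in> U \<and> is_lift J g U F \<and>
     (\<forall>Y\<in>U \<inter> quadric J. \<forall>u\<in>quadric_tangent J Y. \<forall>w\<in>quadric_tangent J Y.
        aform J (frechet_derivative F (at Y) u) (frechet_derivative F (at Y) w) = aform J u w))"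

definition Isom_HH :: "'n::finite set \<Rightarrow> ('n amb set \<Rightarrow> 'n amb set) set" where
  "Isom_HH J = {g \<in> Bij (HH J).
     smooth_HH J g \<and> smooth_HH J (inv_into (HH J) g) \<and> preserves_metric_HH J g}"


definition \<iota> :: "'n::finite set \<Rightarrow> 'n half \<Rightarrow> 'n amb set" where
  "\<iota> J = (\<lambda>(v, z). cls ((1 / z) *\<^sub>R v,
     (1 - h J v - z\<^sup>2) / (2 * z),
     (1 + h J v + z\<^sup>2) / (2 * z)))"

definition complement :: "'n::finite set \<Rightarrow> 'n amb set set" where
  "complement J = HH J - \<iota> J ` half_space"

definition induces :: "'n::finite set \<Rightarrow> ('n half \<Rightarrow> 'n half) \<Rightarrow> ('n amb set \<Rightarrow> 'n amb set) \<Rightarrow> bool" where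
  "induces J g \<phi> \<longleftrightarrow> \<phi> \<in> Isom_HH J \<and> (\<forall>a\<in>half_space. \<phi> (\<iota> J a) = \<iota> J (g a))"

definition hat :: "'n::finite set \<Rightarrow> ('n half \<Rightarrow> 'n half) \<Rightarrow> ('n amb set \<Rightarrow> 'n amb set)" where
  "hat J g = (THE \<phi>. induces J g \<phi>)"

definition bij_group_on :: "'a set \<Rightarrow> ('a \<Rightarrow> 'a) set \<Rightarrow> ('a \<Rightarrow> 'a) monoid" where
  "bij_group_on S K = BijGroup S \<lparr>carrier := K\<rparr>"


text \<open>Subsets \<open>N\<close> of \<open>HH J\<close> are studied through their preimages in the quadric, which is
  locally isometric to \<open>HH J\<close>.\<close>

definition lift_set :: "'n::finite set \<Rightarrow> 'n amb set set \<Rightarrow> 'n amb set" where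
  "lift_set J N = {X \<in> quadric J. cls X \<in> N}"

definition velocities :: "'a::real_normed_vector set \<Rightarrow> 'a \<Rightarrow> 'a set" where
  "velocities S X = {v. \<exists>\<sigma> e. e > 0 \<and> (\<forall>t. \<bar>t\<bar> < e \<longrightarrow> \<sigma> t \<in> S) \<and> \<sigma> 0 = X \<and>
     (\<sigma> has_vector_derivative v) (at (0::real))}"

definition is_hyperplane :: "'n::finite set \<Rightarrow> 'n amb set set \<Rightarrow> bool" where
  "is_hyperplane J N \<longleftrightarrow> (\<exists>W. subspace W \<and> dim W + 1 = DIM('n amb) \<and>
     N = cls ` (quadric J \<inter> W))"

text \<open>The metric induced on \<open>N\<close> is degenerate at each point.\<close>

definition is_degenerate :: "'n::finite set \<Rightarrow> 'n amb set set \<Rightarrow> bool" where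
  "is_degenerate J N \<longleftrightarrow> (\<forall>X\<in>lift_set J N. \<exists>n\<in>velocities (lift_set J N) X.
     n \<noteq> 0 \<and> (\<forall>u\<in>velocities (lift_set J N) X. aform J n u = 0))"

text \<open>The covariant derivative of the induced metric is the tangential part of the derivative
  in the ambient space, so a curve is a geodesic iff its acceleration is normal to the quadric.\<close>

definition geodesic_on :: "'n::finite set \<Rightarrow> real set \<Rightarrow> (real \<Rightarrow> 'n amb) \<Rightarrow> bool" where
  "geodesic_on J I c \<longleftrightarrow> (\<exists>c' c''. \<forall>t\<in>I. c t \<in> quadric J \<and>
     (c has_vector_derivative c' t) (at t) \<and> (c' has_vector_derivative c'' t) (at t) \<and>
     (\<forall>u\<in>quadric_tangent J (c t). aform J (c'' t) u = 0))"

definition totally_geodesic :: "'n::finite set \<Rightarrow> 'n amb set set \<Rightarrow> bool" where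
  "totally_geodesic J N \<longleftrightarrow> (\<forall>c a b. a < 0 \<longrightarrow> 0 < b \<longrightarrow> geodesic_on J {a<..<b} c \<longrightarrow>
     c 0 \<in> lift_set J N \<longrightarrow> vector_derivative c (at 0) \<in> velocities (lift_set J N) (c 0) \<longrightarrow>
     (\<forall>t\<in>{a<..<b}. c t \<in> lift_set J N))"

end

theory Submission
  imports Defs
begin

text \<open>
  The argument is linear algebra in the ambient space. The hyperplane \<open>complement J\<close> is
  cut out of the pseudo-hyperbolic space by the linear form \<open>alpha X\<close> =
  \<open>X\<^sub>p + X\<^sub>p\<^sub>+\<^sub>q\<^sub>+\<^sub>1\<close>, and \<open>alpha\<close> is the product with
  the lightlike vector \<open>null_vec\<close> = \<open>(0, 1, -1)\<close>. A point outside of the hyperplane has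
  exactly one representative with \<open>alpha > 0\<close>; the half-space is a chart of the set
  \<open>upper J\<close> of these representatives, with \<open>z\<close> = \<open>1 / alpha\<close>. Because \<open>null_vec\<close> is
  lightlike, it is tangent to the kernel of \<open>alpha\<close> and orthogonal to it, so the
  hyperplane is degenerate. Along a geodesic \<open>c\<close> of the quadric the acceleration is
  \<open>\<mu> *\<^sub>R c\<close> with a constant \<open>\<mu>\<close>, so \<open>alpha (c t)\<close> solves a linear equation
  of second order and vanishes identically if it does so to first order at one time; hence
  the hyperplane is totally geodesic.

  Every similarity \<open>(v, z) \<mapsto> r (A v + v\<^sub>0, z)\<close> scales the numerator and the
  denominator of the metric by \<open>r\<^sup>2\<close>, so it is an isometry of the half-space. It is
  the restriction of an explicit linear isometry of the ambient space that multiplies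
  \<open>alpha\<close> by \<open>1 / r\<close> (\<open>lift_sim\<close>). So it induces an isometry of the pseudo-hyperbolic
  space, which is unique by continuity, because the chart is dense (\<open>Isom_HH_eqI\<close>).

  The converse is a rigidity statement (\<open>quadric_rigidity\<close>) which serves both for the
  isometries of the half-space and for the isometries of the pseudo-hyperbolic space that
  stabilise the hyperplane. A map \<open>\<tau>\<close> of \<open>upper J\<close> that is locally isometric extends
  to a map \<open>T\<close> of the cone over \<open>upper J\<close>, homogeneous of degree one. This cone is a
  connected open subset of a flat space, and \<open>T\<close> preserves the flat metric. Its second
  derivative vanishes: the trilinear form \<open>B (D\<^sup>2T(u,v), DT(w))\<close> is symmetric in
  \<open>u, v\<close>, and differentiating \<open>B (DT(u), DT(w)) = B(u, w)\<close> shows that it is skew in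
  \<open>u, w\<close>. So \<open>T\<close> is affine (\<open>flat_rigidity\<close>), and by homogeneity linear. Finally, a linear
  isometry that maps the cone to itself must preserve the kernel of \<open>alpha\<close>, because this
  kernel bounds the cone; hence it multiplies \<open>null_vec\<close> by a positive number, and in the
  chart it is a similarity (\<open>cone_isometry_is_similarity\<close>).
\<close>

section \<open>Calculus of continuously differentiable maps\<close>

lemma Ck_on_SucD:
  assumes "Ck_on (Suc k) S f" and "x \<in> S"
  shows "(f has_derivative frechet_derivative f (at x)) (at x)"
  using assms by (auto simp: frechet_derivative_works)

lemma Ck_on_cong:
  assumes "open S" and "\<And>x. x \<in> S \<Longrightarrow> f x = g x" and "Ck_on k S f"
  shows "Ck_on k S g"
  using assms(2,3)
proof (induction k arbitrary: f g)
  case 0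
  then show ?case by (metis Ck_on.simps(1) continuous_on_cong)
next
  case (Suc k)
  have der: "(g has_derivative frechet_derivative f (at x)) (at x)" if "x \<in> S" for x
    using has_derivative_transform_within_open[OF Ck_on_SucD[OF Suc.prems(2) that] \<open>open S\<close> that]
      Suc.prems(1) by simp
  have "Ck_on k S (\<lambda>x. frechet_derivative g (at x) v)" for v
  proof (rule Suc.IH)
    show "Ck_on k S (\<lambda>x. frechet_derivative f (at x) v)" using Suc.prems(2) by simp
    show "frechet_derivative f (at x) v = frechet_derivative g (at x) v" if "x \<in> S" for x
      using frechet_derivative_at[OF der[OF that]] by simp
  qed
  then show ?case using der by (auto simp: differentiable_def)
qed

lemma Ck_on_SucI:
  assumes "open S" and "\<And>x. x \<in> S \<Longrightarrow> (f has_derivative f' x) (at x)"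
    and "\<And>v. Ck_on k S (\<lambda>x. f' x v)"
  shows "Ck_on (Suc k) S f"
proof -
  have "Ck_on k S (\<lambda>x. frechet_derivative f (at x) v)" for v
    using assms(3) by (rule Ck_on_cong[OF assms(1), rotated])
      (simp add: frechet_derivative_at[OF assms(2)])
  then show ?thesis using assms(2) by (auto simp: differentiable_def)
qed

lemma Ck_on_SucE: "Ck_on (Suc k) S f \<Longrightarrow> Ck_on k S f"
proof (induction k arbitrary: f)
  case 0
  then show ?case
    by (auto intro!: continuous_at_imp_continuous_on differentiable_imp_continuous_within)
next
  case (Suc k)
  have "Ck_on k S (\<lambda>x. frechet_derivative f (at x) v)" for v
    using Suc.prems by (intro Suc.IH) simp
  then show ?case using Suc.prems by simp
qed

lemma Ck_on_subset: "Ck_on k S f \<Longrightarrow> T \<subseteq> S \<Longrightarrow> Ck_on k T f"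
proof (induction k arbitrary: f)
  case 0
  then show ?case by (auto intro: continuous_on_subset)
next
  case (Suc k)
  then show ?case by (auto simp: subset_iff)
qed

lemma Ck_on_local:
  assumes "\<And>x. x \<in> S \<Longrightarrow> \<exists>U. open U \<and> x \<in> U \<and> Ck_on k U f"
  shows "Ck_on k S f"
  using assms
proof (induction k arbitrary: f)
  case 0
  have "continuous (at x) f" if "x \<in> S" for x
    using 0[OF that] by (auto simp: continuous_on_eq_continuous_at)
  then show ?case by (simp add: continuous_at_imp_continuous_on)
next
  case (Suc k)
  show ?case unfolding Ck_on.simps
  proof (intro conjI ballI allI)
    fix x assume "x \<in> S"
    then show "f differentiable (at x)" using Suc.prems[of x] by auto
  next
    fix v show "Ck_on k S (\<lambda>x. frechet_derivative f (at x) v)"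
    proof (rule Suc.IH)
      fix x assume "x \<in> S"
      then show "\<exists>U. open U \<and> x \<in> U \<and> Ck_on k U (\<lambda>x. frechet_derivative f (at x) v)"
        using Suc.prems[of x] by auto
    qed
  qed
qed

lemma Ck_on_const: "open S \<Longrightarrow> Ck_on k S (\<lambda>x. c)"
proof (induction k arbitrary: c)
  case (Suc k)
  show ?case by (rule Ck_on_SucI[where f' = "\<lambda>x v. 0"]) (simp_all add: Suc)
qed simp

lemma Ck_on_linear_comp:
  fixes L :: "'b::euclidean_space \<Rightarrow> 'c::euclidean_space"
  assumes "linear L" and "open S" and "Ck_on k S f"
  shows "Ck_on k S (\<lambda>x. L (f x))"
  using assms(3)
proof (induction k arbitrary: f)
  case 0
  then show ?case using linear_continuous_on_compose[OF _ assms(1)] by (simp add: o_def)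
next
  case (Suc k)
  have bl: "bounded_linear L" using assms(1) by (simp add: linear_conv_bounded_linear)
  show ?case
  proof (rule Ck_on_SucI[OF assms(2)])
    show "((\<lambda>x. L (f x)) has_derivative (\<lambda>v. L (frechet_derivative f (at x) v))) (at x)"
      if "x \<in> S" for x
      by (rule bounded_linear.has_derivative[OF bl Ck_on_SucD[OF Suc.prems that]])
    show "Ck_on k S (\<lambda>x. L (frechet_derivative f (at x) v))" for v
      using Suc.prems by (intro Suc.IH) simp
  qed
qed

lemma Ck_on_id: "open S \<Longrightarrow> Ck_on k S (\<lambda>x. x)"
proof (induction k)
  case (Suc k)
  show ?case
    by (rule Ck_on_SucI[where f' = "\<lambda>x v. v"]) (simp_all add: Suc.prems Ck_on_const)
qed (simp add: continuous_on_id)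

lemma Ck_on_linear: "linear L \<Longrightarrow> open S \<Longrightarrow> Ck_on k S L"
  by (rule Ck_on_linear_comp[OF _ _ Ck_on_id])

lemma Ck_on_add:
  assumes "open S" and "Ck_on k S f" and "Ck_on k S g"
  shows "Ck_on k S (\<lambda>x. f x + g x)"
  using assms(2,3)
proof (induction k arbitrary: f g)
  case 0
  then show ?case by (simp add: continuous_on_add)
next
  case (Suc k)
  show ?case
  proof (rule Ck_on_SucI[OF assms(1)])
    show "((\<lambda>x. f x + g x) has_derivative
        (\<lambda>v. frechet_derivative f (at x) v + frechet_derivative g (at x) v)) (at x)"
      if "x \<in> S" for x
      by (intro has_derivative_add Suc.prems[THEN Ck_on_SucD] that)
    show "Ck_on k S (\<lambda>x. frechet_derivative f (at x) v + frechet_derivative g (at x) v)" for v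
      using Suc.prems by (intro Suc.IH) simp_all
  qed
qed

lemma Ck_on_sum:
  assumes "open S" and "finite I" and "\<And>i. i \<in> I \<Longrightarrow> Ck_on k S (f i)"
  shows "Ck_on k S (\<lambda>x. \<Sum>i\<in>I. f i x)"
  using assms(2,3)
  by (induction I rule: finite_induct) (simp_all add: Ck_on_const Ck_on_add assms(1))

lemma Ck_on_bilinear:
  fixes B :: "'b::euclidean_space \<Rightarrow> 'c::euclidean_space \<Rightarrow> 'd::euclidean_space"
  assumes "bounded_bilinear B" and "open S" and "Ck_on k S f" and "Ck_on k S g"
  shows "Ck_on k S (\<lambda>x. B (f x) (g x))"
  using assms(3,4)
proof (induction k arbitrary: f g)
  case 0
  then show ?case by (simp add: bounded_bilinear.continuous_on[OF assms(1)])
next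
  case (Suc k)
  show ?case
  proof (rule Ck_on_SucI[OF assms(2)])
    show "((\<lambda>x. B (f x) (g x)) has_derivative
        (\<lambda>v. B (f x) (frechet_derivative g (at x) v) + B (frechet_derivative f (at x) v) (g x)))
        (at x)" if "x \<in> S" for x
      by (intro bounded_bilinear.FDERIV[OF assms(1)] Suc.prems[THEN Ck_on_SucD] that)
    show "Ck_on k S (\<lambda>x. B (f x) (frechet_derivative g (at x) v) +
        B (frechet_derivative f (at x) v) (g x))" for v
      using Suc.prems Suc.prems[THEN Ck_on_SucE]
      by (intro Ck_on_add assms(2) Suc.IH) simp_all
  qed
qed

lemmas Ck_on_scaleR = Ck_on_bilinear[OF bounded_bilinear_scaleR]
lemmas Ck_on_mult_real = Ck_on_bilinear[OF bounded_bilinear_mult[where 'a = real]]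

text \<open>
  The chain rule expresses the directional derivative of a composition by the derivative
  of the outer map in a direction that moves with the point. Expanding this direction in a
  basis leaves directional derivatives in fixed directions, to which the induction
  hypothesis applies.
\<close>

lemma Ck_on_compose:
  assumes "open S" and "open T" and "\<And>x. x \<in> S \<Longrightarrow> g x \<in> T"
    and "Ck_on k T f" and "Ck_on k S g"
  shows "Ck_on k S (\<lambda>x. f (g x))"
  using assms(4,5)
proof (induction k arbitrary: f)
  case 0
  then show ?case using assms(3) by (auto intro: continuous_on_compose2)
next
  case (Suc k)
  let ?f' = "\<lambda>y. frechet_derivative f (at y)" and ?g' = "\<lambda>x. frechet_derivative g (at x)"
  show ?case
  proof (rule Ck_on_SucI[OF assms(1)])
    fix x assume x: "x \<in> S"
    have f': "(f has_derivative ?f' (g x)) (at (g x))"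
      by (rule Ck_on_SucD[OF Suc.prems(1) assms(3)[OF x]])
    have "((\<lambda>x. f (g x)) has_derivative (\<lambda>v. ?f' (g x) (?g' x v))) (at x)"
      by (rule has_derivative_compose[OF Ck_on_SucD[OF Suc.prems(2) x] f'])
    moreover have "(\<lambda>v. ?f' (g x) (?g' x v)) =
        (\<lambda>v. \<Sum>b\<in>Basis. (?g' x v \<bullet> b) *\<^sub>R ?f' (g x) b)"
    proof
      fix v
      have "?f' (g x) (\<Sum>b\<in>Basis. (?g' x v \<bullet> b) *\<^sub>R b) =
          (\<Sum>b\<in>Basis. (?g' x v \<bullet> b) *\<^sub>R ?f' (g x) b)"
        unfolding linear_sum[OF has_derivative_linear[OF f']]
          linear_scale[OF has_derivative_linear[OF f']] ..
      then show "?f' (g x) (?g' x v) = (\<Sum>b\<in>Basis. (?g' x v \<bullet> b) *\<^sub>R ?f' (g x) b)"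
        by (simp only: euclidean_representation)
    qed
    ultimately show "((\<lambda>x. f (g x)) has_derivative
        (\<lambda>v. \<Sum>b\<in>Basis. (?g' x v \<bullet> b) *\<^sub>R ?f' (g x) b)) (at x)"
      by (rule has_derivative_eq_rhs)
  next
    fix v
    have g1: "Ck_on k S (\<lambda>x. ?g' x v)" using Suc.prems(2) by simp
    have "Ck_on k S (\<lambda>x. ?g' x v \<bullet> b)" for b
      by (rule Ck_on_linear_comp[OF _ assms(1) g1])
        (simp add: bounded_linear.linear bounded_linear_inner_left)
    moreover have "Ck_on k S (\<lambda>x. ?f' (g x) b)" for b
      using Suc.prems(1) by (intro Suc.IH Ck_on_SucE[OF Suc.prems(2)]) simp
    ultimately show "Ck_on k S (\<lambda>x. \<Sum>b\<in>Basis. (?g' x v \<bullet> b) *\<^sub>R ?f' (g x) b)"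
      by (intro Ck_on_sum Ck_on_scaleR assms(1)) auto
  qed
qed

lemma Ck_on_Pair:
  assumes "open S" and "Ck_on k S f" and "Ck_on k S g"
  shows "Ck_on k S (\<lambda>x. (f x, g x))"
proof -
  have "Ck_on k S (\<lambda>x. (f x, 0) + (0, g x))"
    by (intro Ck_on_add assms(1)
        Ck_on_linear_comp[OF _ assms(1,2), of "\<lambda>y. (y, 0)"]
        Ck_on_linear_comp[OF _ assms(1,3), of "\<lambda>y. (0, y)"])
      (auto intro!: linearI)
  then show ?thesis by simp
qed

lemma Ck_on_inverse: "Ck_on k (- {0}) (inverse :: real \<Rightarrow> real)"
proof (induction k)
  case 0
  show ?case by (auto intro!: continuous_intros)
next
  case (Suc k)
  have op: "open (- {0::real})" by auto
  show ?case
  proof (rule Ck_on_SucI[OF op])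
    show "(inverse has_derivative (\<lambda>v. - v * (inverse x * inverse x))) (at x)"
      if "x \<in> - {0}" for x :: real
      using that by (auto intro!: derivative_eq_intros)
    show "Ck_on k (- {0}) (\<lambda>x::real. - v * (inverse x * inverse x))" for v
      by (intro Ck_on_mult_real op Ck_on_const Suc)
  qed
qed

lemma Ck_on_sqrt: "Ck_on k {0<..} sqrt"
proof (induction k)
  case 0
  show ?case by (auto intro!: continuous_intros)
next
  case (Suc k)
  have op: "open {0::real<..}" by auto
  show ?case
  proof (rule Ck_on_SucI[OF op])
    show "(sqrt has_derivative (\<lambda>v. v / 2 * inverse (sqrt x))) (at x)"
      if "x \<in> {0<..}" for x
      using that by (auto intro!: derivative_eq_intros)
    show "Ck_on k {0<..} (\<lambda>x. v / 2 * inverse (sqrt x))" for v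
      by (intro Ck_on_mult_real op Ck_on_const Ck_on_compose[OF op _ _ Ck_on_inverse Suc]) auto
  qed
qed


section \<open>Symmetry of the second derivative\<close>

text \<open>
  Two applications of the mean value theorem, first along \<open>u\<close> and then along \<open>v\<close>. The
  difference on the left is symmetric in \<open>u\<close> and \<open>v\<close>, the derivative on the right is not;
  this is what makes the second derivative symmetric in the limit.
\<close>

lemma mixed_difference_mean_value:
  fixes f :: "'a::euclidean_space \<Rightarrow> real"
  assumes f: "Ck_on 2 (ball x r) f" and "t > 0" and small: "t * (norm u + norm v) < r"
  obtains y where "dist x y \<le> t * (norm u + norm v)"
    and "f (x + t *\<^sub>R u + t *\<^sub>R v) - f (x + t *\<^sub>R u) - f (x + t *\<^sub>R v) + f x =
      t\<^sup>2 * frechet_derivative (\<lambda>y. frechet_derivative f (at y) u) (at y) v"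
proof -
  let ?f' = "\<lambda>y. frechet_derivative f (at y)"
  let ?g = "\<lambda>y. ?f' y u"
  let ?g' = "\<lambda>y. frechet_derivative ?g (at y)"
  have f2: "Ck_on (Suc (Suc 0)) (ball x r) f" using f by (simp only: numeral_2_eq_2)
  have g1: "Ck_on (Suc 0) (ball x r) ?g" using f2 by (auto simp only: Ck_on.simps)
  have bound: "norm (a *\<^sub>R u + b *\<^sub>R v) \<le> t * (norm u + norm v)"
    if "0 \<le> a" "a \<le> t" "0 \<le> b" "b \<le> t" for a b
  proof -
    have "norm (a *\<^sub>R u + b *\<^sub>R v) \<le> a * norm u + b * norm v"
      using norm_triangle_ineq[of "a *\<^sub>R u" "b *\<^sub>R v"] that by simp
    also have "\<dots> \<le> t * norm u + t * norm v"
      using that by (intro add_mono mult_right_mono) auto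
    finally show ?thesis by (simp add: algebra_simps)
  qed
  have dist_eq: "dist x (x + a *\<^sub>R u + b *\<^sub>R v) = norm (a *\<^sub>R u + b *\<^sub>R v)" for a b
    by (metis add.assoc add_diff_cancel_left' dist_commute dist_norm)
  have inb: "x + a *\<^sub>R u + b *\<^sub>R v \<in> ball x r" if "0 \<le> a" "a \<le> t" "0 \<le> b" "b \<le> t" for a b
    using bound[OF that] small by (simp add: dist_eq)
  have df: "((\<lambda>s. f (p + s *\<^sub>R w)) has_derivative (\<lambda>k. ?f' (p + s *\<^sub>R w) (k *\<^sub>R w))) (at s)"
    if "p + s *\<^sub>R w \<in> ball x r" for p w s
    by (rule has_derivative_compose[where f = "\<lambda>s. p + s *\<^sub>R w", OF _ Ck_on_SucD[OF f2 that]])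
      (auto intro!: derivative_eq_intros)
  have dg: "((\<lambda>s. ?g (p + s *\<^sub>R w)) has_derivative (\<lambda>k. ?g' (p + s *\<^sub>R w) (k *\<^sub>R w))) (at s)"
    if "p + s *\<^sub>R w \<in> ball x r" for p w s
    by (rule has_derivative_compose[where f = "\<lambda>s. p + s *\<^sub>R w", OF _ Ck_on_SucD[OF g1 that]])
      (auto intro!: derivative_eq_intros)
  have in1: "x + t *\<^sub>R v + s *\<^sub>R u \<in> ball x r" "x + s *\<^sub>R u \<in> ball x r" if "0 \<le> s" "s \<le> t" for s
    using inb[of s t] inb[of s 0] that \<open>t > 0\<close> by (simp_all add: add_ac)
  have "\<exists>\<xi>\<in>{0<..<t}. (f (x + t *\<^sub>R v + t *\<^sub>R u) - f (x + t *\<^sub>R u)) -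
      (f (x + t *\<^sub>R v + 0 *\<^sub>R u) - f (x + 0 *\<^sub>R u)) =
      (\<lambda>k. ?f' (x + t *\<^sub>R v + \<xi> *\<^sub>R u) (k *\<^sub>R u) - ?f' (x + \<xi> *\<^sub>R u) (k *\<^sub>R u)) (t - 0)"
    using in1
    by (intro mvt_simple[OF \<open>t > 0\<close>] has_derivative_at_withinI[OF has_derivative_diff] df) auto
  then obtain \<xi> where \<xi>: "0 < \<xi>" "\<xi> < t" and
    eq1: "f (x + t *\<^sub>R v + t *\<^sub>R u) - f (x + t *\<^sub>R u) - f (x + t *\<^sub>R v) + f x =
      ?f' (x + t *\<^sub>R v + \<xi> *\<^sub>R u) (t *\<^sub>R u) - ?f' (x + \<xi> *\<^sub>R u) (t *\<^sub>R u)"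
    by auto
  have lin: "?f' y (t *\<^sub>R u) = t * ?g y" if "y \<in> ball x r" for y
    using linear_scale[OF has_derivative_linear[OF Ck_on_SucD[OF f2 that]]] by simp
  have in2: "x + \<xi> *\<^sub>R u + s *\<^sub>R v \<in> ball x r" if "0 \<le> s" "s \<le> t" for s
    using inb[of \<xi> s] that \<xi> by simp
  have "\<exists>\<eta>\<in>{0<..<t}. ?g (x + \<xi> *\<^sub>R u + t *\<^sub>R v) - ?g (x + \<xi> *\<^sub>R u + 0 *\<^sub>R v) =
      (\<lambda>k. ?g' (x + \<xi> *\<^sub>R u + \<eta> *\<^sub>R v) (k *\<^sub>R v)) (t - 0)"
    using in2 by (intro mvt_simple[OF \<open>t > 0\<close>] has_derivative_at_withinI[OF dg]) auto
  then obtain \<eta> where \<eta>: "0 < \<eta>" "\<eta> < t" and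
    eq2: "?g (x + \<xi> *\<^sub>R u + t *\<^sub>R v) - ?g (x + \<xi> *\<^sub>R u) =
      ?g' (x + \<xi> *\<^sub>R u + \<eta> *\<^sub>R v) (t *\<^sub>R v)"
    by auto
  have lin2: "?g' y (t *\<^sub>R v) = t * ?g' y v" if "y \<in> ball x r" for y
    using linear_scale[OF has_derivative_linear[OF Ck_on_SucD[OF g1 that]]] by simp
  show thesis
  proof (rule that[of "x + \<xi> *\<^sub>R u + \<eta> *\<^sub>R v"])
    show "dist x (x + \<xi> *\<^sub>R u + \<eta> *\<^sub>R v) \<le> t * (norm u + norm v)"
      using bound[of \<xi> \<eta>] \<xi> \<eta> by (simp add: dist_eq)
    have e1: "x + t *\<^sub>R v + \<xi> *\<^sub>R u = x + \<xi> *\<^sub>R u + t *\<^sub>R v"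
      and e2: "x + t *\<^sub>R v + t *\<^sub>R u = x + t *\<^sub>R u + t *\<^sub>R v"
      by (simp_all add: add_ac)
    have "f (x + t *\<^sub>R u + t *\<^sub>R v) - f (x + t *\<^sub>R u) - f (x + t *\<^sub>R v) + f x =
        t * (?g (x + \<xi> *\<^sub>R u + t *\<^sub>R v) - ?g (x + \<xi> *\<^sub>R u))"
      using eq1 lin[OF in2[of t]] lin[OF in2[of 0]] \<open>t > 0\<close>
      by (simp add: e1 e2 right_diff_distrib)
    also have "\<dots> = t\<^sup>2 * ?g' (x + \<xi> *\<^sub>R u + \<eta> *\<^sub>R v) v"
      using eq2 lin2[OF in2[of \<eta>]] \<eta> by (simp add: power2_eq_square)
    finally show "f (x + t *\<^sub>R u + t *\<^sub>R v) - f (x + t *\<^sub>R u) - f (x + t *\<^sub>R v) + f x =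
        t\<^sup>2 * ?g' (x + \<xi> *\<^sub>R u + \<eta> *\<^sub>R v) v" .
  qed
qed

lemma second_derivative_symmetric_real:
  fixes f :: "'a::euclidean_space \<Rightarrow> real"
  assumes "open S" and "x \<in> S" and f: "Ck_on 2 S f"
  shows "frechet_derivative (\<lambda>y. frechet_derivative f (at y) u) (at x) v =
    frechet_derivative (\<lambda>y. frechet_derivative f (at y) v) (at x) u"
proof -
  let ?D = "\<lambda>u v y. frechet_derivative (\<lambda>y. frechet_derivative f (at y) u) (at y) v"
  obtain r where r: "r > 0" "ball x r \<subseteq> S" using assms(1,2) openE by blast
  have fr: "Ck_on 2 (ball x r) f" by (rule Ck_on_subset[OF f r(2)])
  have cont: "continuous (at x) (?D u v)" for u v
  proof -
    have "continuous_on S (?D u v)" using f by (simp add: numeral_2_eq_2)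
    then show ?thesis using assms(1,2) continuous_on_eq_continuous_at by blast
  qed
  let ?q = "\<lambda>u v t. (f (x + t *\<^sub>R u + t *\<^sub>R v) - f (x + t *\<^sub>R u) - f (x + t *\<^sub>R v) + f x) / t\<^sup>2"
  have lim: "(?q u v \<longlongrightarrow> ?D u v x) (at_right 0)" for u v
  proof (rule tendstoI)
    fix e :: real assume "e > 0"
    then obtain d where d: "d > 0" "\<And>y. dist y x < d \<Longrightarrow> dist (?D u v y) (?D u v x) < e"
      using cont[of u v] by (auto simp: continuous_at_eps_delta)
    let ?N = "norm u + norm v + 1"
    have N: "?N > 0" by (smt (verit) norm_ge_zero)
    have "eventually (\<lambda>t. t \<in> {0<..<min d r / ?N}) (at_right 0)"
      using d(1) r(1) N by (intro eventually_at_right_real) auto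
    then show "eventually (\<lambda>t. dist (?q u v t) (?D u v x) < e) (at_right 0)"
    proof eventually_elim
      case (elim t)
      then have t: "t > 0" "t * ?N < min d r" using N by (simp_all add: pos_less_divide_eq)
      then have sm: "t * (norm u + norm v) < min d r" by (simp add: algebra_simps)
      then obtain y where y: "dist x y \<le> t * (norm u + norm v)"
          "f (x + t *\<^sub>R u + t *\<^sub>R v) - f (x + t *\<^sub>R u) - f (x + t *\<^sub>R v) + f x = t\<^sup>2 * ?D u v y"
        using mixed_difference_mean_value[OF fr t(1), of u v] by auto
      then have "?q u v t = ?D u v y" using t(1) by simp
      then show ?case using d(2)[of y] y(1) sm by (simp add: dist_commute)
    qed
  qed
  have "?q u v = ?q v u" by (auto simp: add_ac fun_eq_iff)
  then show ?thesis
    using tendsto_unique[OF _ lim[of u v]] lim[of v u] by simp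
qed

lemma second_derivative_symmetric:
  fixes f :: "'a::euclidean_space \<Rightarrow> 'b::euclidean_space"
  assumes "open S" and "x \<in> S" and f: "Ck_on 2 S f"
  shows "frechet_derivative (\<lambda>y. frechet_derivative f (at y) u) (at x) v =
    frechet_derivative (\<lambda>y. frechet_derivative f (at y) v) (at x) u"
proof (rule euclidean_eqI)
  fix b :: 'b assume "b \<in> Basis"
  have f2: "Ck_on (Suc (Suc 0)) S f" using f by (simp only: numeral_2_eq_2)
  have lin: "linear (\<lambda>y. y \<bullet> b)" by (simp add: bounded_linear.linear bounded_linear_inner_left)
  have D1: "frechet_derivative (\<lambda>y. f y \<bullet> b) (at y) w = frechet_derivative f (at y) w \<bullet> b"
    if "y \<in> S" for y w
    using frechet_derivative_at[OF bounded_linear.has_derivative[OF bounded_linear_inner_left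
          Ck_on_SucD[OF f2 that]], of b] by metis
  have D2: "frechet_derivative (\<lambda>y. frechet_derivative (\<lambda>y. f y \<bullet> b) (at y) w) (at x) w' =
      frechet_derivative (\<lambda>y. frechet_derivative f (at y) w) (at x) w' \<bullet> b" for w w'
  proof -
    have "Ck_on (Suc 0) S (\<lambda>y. frechet_derivative f (at y) w)"
      using f2 by (auto simp only: Ck_on.simps)
    from bounded_linear.has_derivative[OF bounded_linear_inner_left Ck_on_SucD[OF this assms(2)]]
    have "((\<lambda>y. frechet_derivative (\<lambda>y. f y \<bullet> b) (at y) w) has_derivative
        (\<lambda>w'. frechet_derivative (\<lambda>y. frechet_derivative f (at y) w) (at x) w' \<bullet> b)) (at x)"
      by (rule has_derivative_transform_within_open[OF _ assms(1,2)]) (simp add: D1)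
    then show ?thesis using frechet_derivative_at by metis
  qed
  have "Ck_on 2 S (\<lambda>y. f y \<bullet> b)" by (rule Ck_on_linear_comp[OF lin assms(1) f])
  from second_derivative_symmetric_real[OF assms(1,2) this, of u v]
  show "frechet_derivative (\<lambda>y. frechet_derivative f (at y) u) (at x) v \<bullet> b =
      frechet_derivative (\<lambda>y. frechet_derivative f (at y) v) (at x) u \<bullet> b"
    by (simp add: D2)
qed


section \<open>Linear isometries of a nondegenerate form\<close>

lemma isometry_polarization:
  fixes B :: "'a::real_normed_vector \<Rightarrow> 'a \<Rightarrow> real"
  assumes "bounded_bilinear B" and "\<And>x y. B x y = B y x"
    and "linear L" and "\<And>x. B (L x) (L x) = B x x"
  shows "B (L x) (L y) = B x y"
proof -
  interpret bounded_bilinear B by fact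
  have "B (L x + L y) (L x + L y) = B (x + y) (x + y)"
    using assms(4)[of "x + y"] by (simp add: linear_add[OF assms(3)])
  then have "B (L x) (L y) + B (L y) (L x) = B x y + B y x"
    by (simp add: add_left add_right assms(4))
  then show ?thesis using assms(2)[of "L x" "L y"] assms(2)[of x y] by simp
qed

text \<open>
  A vector in the kernel of \<open>L\<close> is orthogonal to everything, so \<open>L\<close> is injective; the
  dimension is finite.
\<close>

lemma isometry_bij:
  fixes B :: "'a::euclidean_space \<Rightarrow> 'a \<Rightarrow> real"
  assumes "bounded_bilinear B" and nondeg: "\<And>x. (\<And>y. B x y = 0) \<Longrightarrow> x = 0"
    and "linear L" and iso: "\<And>x y. B (L x) (L y) = B x y"
  shows "bij L"
proof -
  interpret bounded_bilinear B by fact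
  have "x = 0" if "L x = 0" for x
  proof (rule nondeg)
    show "B x y = 0" for y using iso[of x y] that by (simp add: zero_left)
  qed
  then have "inj L" using linear_injective_0[OF assms(3)] by blast
  then show ?thesis using linear_injective_imp_surjective[OF assms(3)] by (simp add: bij_def)
qed

lemma isometry_inv:
  fixes B :: "'a::euclidean_space \<Rightarrow> 'a \<Rightarrow> real"
  assumes "linear L" and "bij L" and "\<And>x. B (L x) (L x) = B x x"
  shows "linear (inv_into UNIV L)" and "B (inv_into UNIV L x) (inv_into UNIV L x) = B x x"
proof -
  have L: "L (inv_into UNIV L x) = x" for x using assms(2) by (simp add: bij_is_surj surj_f_inv_f)
  then show "B (inv_into UNIV L x) (inv_into UNIV L x) = B x x" using assms(3)[of "inv_into UNIV L x"] by simp
  have inj: "L x = L y \<Longrightarrow> x = y" for x y using assms(2) by (simp add: bij_def inj_eq)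
  show "linear (inv_into UNIV L)"
    by (rule linearI; rule inj) (simp_all add: L linear_add[OF assms(1)] linear_scale[OF assms(1)])
qed


section \<open>The forms of the model spaces\<close>

lemma hform_commute: "hform J v w = hform J w v"
  by (simp add: hform_def mult.commute)

lemma bounded_bilinear_hform: "bounded_bilinear (hform J)"
  by (rule bilinear_conv_bounded_bilinear[THEN iffD1])
    (auto simp: bilinear_def hform_def algebra_simps sum.distrib sum_distrib_left intro!: linearI)

interpretation hform: bounded_bilinear "hform J" for J
  by (rule bounded_bilinear_hform)

lemma hform_axis: "hform J v (axis i 1) = (if i \<in> J then - v $ i else v $ i)"
  by (simp add: hform_def axis_def if_distrib[of "\<lambda>x. _ * x"] sum.delta cong: if_cong)

lemma hform_nondegenerate: "(\<And>w. hform J v w = 0) \<Longrightarrow> v = 0"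
  by (metis hform_axis neg_equal_0_iff_equal vec_eq_iff zero_index)

lemma aform_commute: "aform J X Y = aform J Y X"
  by (simp add: aform_def hform_commute mult.commute)

lemma bounded_bilinear_aform: "bounded_bilinear (aform J)"
  by (rule bilinear_conv_bounded_bilinear[THEN iffD1])
    (auto simp: bilinear_def aform_def algebra_simps hform.add_left hform.add_right
      hform.scaleR_left hform.scaleR_right intro!: linearI)

interpretation aform: bounded_bilinear "aform J" for J
  by (rule bounded_bilinear_aform)

lemma aform_nondegenerate: "X = 0" if "\<And>Y. aform J X Y = 0" for X :: "'n::finite amb"
proof -
  have "hform J (fst X) w = 0" for w
    using that[of "(w, 0, 0)"] by (simp add: aform_def)
  then have "fst X = 0" by (rule hform_nondegenerate)
  moreover have "fst (snd X) = 0" "snd (snd X) = 0"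
    using that[of "(0, 1, 0)"] that[of "(0, 0, 1)"] by (simp_all add: aform_def hform.zero_right)
  ultimately show ?thesis by (simp add: prod_eq_iff)
qed

lemmas aform_isometry_polarization = isometry_polarization[OF bounded_bilinear_aform aform_commute]

lemma aform_isometry_bij:
  assumes "linear L" and "\<And>X Y. aform J (L X) (L Y) = aform J X Y"
  shows "bij L"
  by (rule isometry_bij[where B = "aform J", OF bounded_bilinear_aform _ assms])
    (rule aform_nondegenerate[of J], simp)

lemma O_groupD:
  assumes "A \<in> O_group J"
  shows "linear A" and "bij A" and "hform J (A v) (A w) = hform J v w"
proof -
  show lin: "linear A" using assms by (simp add: O_group_def)
  show iso: "hform J (A v) (A w) = hform J v w" for v w
    by (rule isometry_polarization[OF bounded_bilinear_hform hform_commute lin])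
      (use assms in \<open>simp add: O_group_def\<close>)
  show "bij A"
    by (rule isometry_bij[where B = "hform J", OF bounded_bilinear_hform _ lin iso])
      (rule hform_nondegenerate[of J], simp)
qed

lemma O_group_inv: "A \<in> O_group J \<Longrightarrow> inv_into UNIV A \<in> O_group J"
proof -
  assume A: "A \<in> O_group J"
  note inv = isometry_inv[OF O_groupD(1,2)[OF A], of "hform J", OF O_groupD(3)[OF A]]
  show ?thesis unfolding O_group_def using inv by blast
qed

lemma O_group_comp: "A \<in> O_group J \<Longrightarrow> B \<in> O_group J \<Longrightarrow> A \<circ> B \<in> O_group J"
  by (auto simp: O_group_def linear_compose)

lemma O_group_id: "id \<in> O_group J"
  by (simp add: O_group_def linear_id)


section \<open>The chart of the quadric\<close>

text \<open>
  The linear form that cuts out the hyperplane. It is the coordinate \<open>1 / z\<close> of the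
  half-space.
\<close>

definition alpha :: "'n::finite amb \<Rightarrow> real" where
  "alpha X = fst (snd X) + snd (snd X)"

definition null_vec :: "'n::finite amb" where
  "null_vec = (0, 1, - 1)"

text \<open>
  The representative with \<open>alpha > 0\<close> of the point \<open>\<iota> J a\<close>.
\<close>

definition lift_pt :: "'n::finite set \<Rightarrow> 'n half \<Rightarrow> 'n amb" where
  "lift_pt J = (\<lambda>(v, z). ((1 / z) *\<^sub>R v, (1 - h J v - z\<^sup>2) / (2 * z), (1 + h J v + z\<^sup>2) / (2 * z)))"

text \<open>
  The inverse of \<open>lift_pt\<close> where \<open>alpha > 0\<close>. It is defined, and smooth, off the quadric
  as well, so that it can be composed with maps between open subsets of the ambient space.
\<close>

definition chart :: "'n::finite amb \<Rightarrow> 'n half" where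
  "chart X = ((1 / alpha X) *\<^sub>R fst X, 1 / alpha X)"

lemma linear_alpha: "linear alpha"
  by (auto intro!: linearI simp: alpha_def algebra_simps)

lemmas alpha_simps [simp] = linear_add[OF linear_alpha] linear_scale[OF linear_alpha]
  linear_neg[OF linear_alpha] linear_diff[OF linear_alpha] linear_0[OF linear_alpha]

lemma aform_null_vec: "aform J null_vec X = alpha X"
  by (simp add: aform_def null_vec_def alpha_def hform.zero_left)

lemma alpha_null_vec [simp]: "alpha null_vec = 0"
  by (simp add: alpha_def null_vec_def)

text \<open>
  In the lightlike coordinates \<open>a + b\<close> and \<open>a - b\<close> the form is affine in the second one.
  Hence a point of the quadric off the hyperplane is determined by \<open>fst\<close> and \<open>alpha\<close>.
\<close>

lemma aform_split:
  "aform J X X = h J (fst X) + alpha X * (fst (snd X) - snd (snd X))"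
  by (simp add: aform_def alpha_def algebra_simps)

lemma quadric_eqI:
  assumes "X \<in> quadric J" and "Y \<in> quadric J" and "fst X = fst Y" and "alpha X = alpha Y"
    and "alpha X \<noteq> 0"
  shows "X = Y"
proof -
  have "alpha X * (fst (snd X) - snd (snd X)) = alpha X * (fst (snd Y) - snd (snd Y))"
    using assms(1,2) unfolding quadric_def mem_Collect_eq aform_split assms(3,4) by linarith
  then have "fst (snd X) - snd (snd X) = fst (snd Y) - snd (snd Y)" using assms(5) by simp
  then have "fst (snd X) = fst (snd Y)" "snd (snd X) = snd (snd Y)"
    using assms(4) by (simp_all add: alpha_def)
  then show ?thesis using assms(3) by (simp add: prod_eq_iff)
qed

lemma alpha_lift_pt: "alpha (lift_pt J (v, z)) = 1 / z"
  by (simp add: alpha_def lift_pt_def add_divide_distrib[symmetric])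

lemma fst_lift_pt: "fst (lift_pt J (v, z)) = (1 / z) *\<^sub>R v"
  by (simp add: lift_pt_def)

lemma lift_pt_in_quadric:
  assumes "z \<noteq> 0" shows "lift_pt J (v, z) \<in> quadric J"
proof -
  have "fst (snd (lift_pt J (v, z))) - snd (snd (lift_pt J (v, z))) = - (h J v + z\<^sup>2) / z"
    using assms by (simp add: lift_pt_def field_simps)
  then have "aform J (lift_pt J (v, z)) (lift_pt J (v, z)) = h J v / z\<^sup>2 - (h J v + z\<^sup>2) / z\<^sup>2"
    by (simp add: aform_split alpha_lift_pt fst_lift_pt hform.scaleR_left hform.scaleR_right
        power2_eq_square minus_divide_left[symmetric] del: minus_add_distrib)
  then show ?thesis using assms by (simp add: quadric_def diff_divide_distrib[symmetric])
qed

lemma chart_lift_pt: "z \<noteq> 0 \<Longrightarrow> chart (lift_pt J (v, z)) = (v, z)"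
  by (simp add: chart_def alpha_lift_pt fst_lift_pt)

lemma lift_pt_chart:
  assumes "X \<in> quadric J" and "alpha X \<noteq> 0"
  shows "lift_pt J (chart X) = X"
  by (rule quadric_eqI[where J = J])
    (use assms in \<open>simp_all add: chart_def lift_pt_in_quadric fst_lift_pt alpha_lift_pt\<close>)

lemma chart_in_half_space: "alpha X > 0 \<Longrightarrow> chart X \<in> half_space"
  by (simp add: chart_def half_space_def)

lemma iota_eq_cls_lift_pt: "\<iota> J a = cls (lift_pt J a)"
  by (cases a) (simp add: \<iota>_def lift_pt_def)

lemma cls_eq_iff: "cls X = cls Y \<longleftrightarrow> Y = X \<or> Y = - X"
  by (auto simp: cls_def doubleton_eq_iff)

lemma quadric_uminus: "- X \<in> quadric J \<longleftrightarrow> X \<in> quadric J"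
  by (simp add: quadric_def aform.minus_left aform.minus_right)

lemma cls_in_HH_iff: "cls X \<in> HH J \<longleftrightarrow> X \<in> quadric J"
  by (auto simp: HH_def cls_eq_iff quadric_uminus)

lemma HH_E:
  assumes "c \<in> HH J" obtains X where "X \<in> quadric J" "c = cls X"
  using assms by (auto simp: HH_def)

lemma cls_in_complement_iff:
  assumes "X \<in> quadric J"
  shows "cls X \<in> complement J \<longleftrightarrow> alpha X = 0"
proof
  assume c: "cls X \<in> complement J"
  show "alpha X = 0"
  proof (rule ccontr)
    assume a: "alpha X \<noteq> 0"
    define Y where "Y = (if alpha X > 0 then X else - X)"
    have Y: "Y \<in> quadric J" "alpha Y > 0" "cls Y = cls X"
      using assms a by (auto simp: Y_def quadric_uminus cls_eq_iff)
    have "cls X = \<iota> J (chart Y)" using lift_pt_chart[of Y J] Y by (simp add: iota_eq_cls_lift_pt)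
    then show False using c chart_in_half_space[OF Y(2)] by (auto simp: complement_def)
  qed
next
  assume a: "alpha X = 0"
  have "cls X \<noteq> \<iota> J b" if b: "b \<in> half_space" for b
  proof
    assume e: "cls X = \<iota> J b"
    obtain v z where [simp]: "b = (v, z)" by (cases b)
    have "alpha (lift_pt J b) = alpha X \<or> alpha (lift_pt J b) = - alpha X"
      using e by (auto simp: iota_eq_cls_lift_pt cls_eq_iff)
    then show False using a b by (simp add: alpha_lift_pt half_space_def)
  qed
  then show "cls X \<in> complement J" using assms by (auto simp: complement_def cls_in_HH_iff)
qed

lemma complement_eq: "complement J = cls ` (quadric J \<inter> {X. alpha X = 0})"
proof (intro equalityI subsetI)
  fix c assume c: "c \<in> complement J"
  then have "c \<in> HH J" by (simp add: complement_def)
  then obtain X where "X \<in> quadric J" "c = cls X" by (rule HH_E)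
  then show "c \<in> cls ` (quadric J \<inter> {X. alpha X = 0})" using c cls_in_complement_iff by blast
next
  fix c assume "c \<in> cls ` (quadric J \<inter> {X. alpha X = 0})"
  then show "c \<in> complement J" using cls_in_complement_iff by blast
qed

lemma lift_set_complement: "lift_set J (complement J) = quadric J \<inter> {X. alpha X = 0}"
  by (auto simp: lift_set_def cls_in_complement_iff)

lemma iota_inj: "inj_on (\<iota> J) half_space"
proof (rule inj_onI)
  fix a b assume ab: "a \<in> half_space" "b \<in> half_space" "\<iota> J a = \<iota> J b"
  obtain v z where a: "a = (v, z)" by (cases a)
  obtain w y where b: "b = (w, y)" by (cases b)
  have z: "z > 0" "y > 0" using ab a b by (auto simp: half_space_def)
  have "lift_pt J b = lift_pt J a \<or> lift_pt J b = - lift_pt J a"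
    using ab(3) by (simp add: iota_eq_cls_lift_pt cls_eq_iff)
  moreover have "lift_pt J b \<noteq> - lift_pt J a"
  proof
    assume "lift_pt J b = - lift_pt J a"
    then have "alpha (lift_pt J b) = - alpha (lift_pt J a)" by simp
    moreover have "1 / y > 0" "1 / z > 0" using z by simp_all
    ultimately show False by (simp add: a b alpha_lift_pt)
  qed
  ultimately show "a = b" using chart_lift_pt[of z J v] chart_lift_pt[of y J w] z a b by simp
qed


section \<open>Rigidity of flat isometries\<close>

text \<open>
  The trilinear form \<open>B (D\<^sup>2T(u,v), DT(w))\<close> is symmetric in its first two arguments
  and skew in the first and the third, hence zero; this is the reason why the Levi-Civita
  connection is unique. As \<open>DT\<close> is bijective and \<open>B\<close> nondegenerate, \<open>D\<^sup>2T = 0\<close>, and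
  \<open>T\<close> is affine on the connected set \<open>S\<close>.
\<close>

lemma flat_rigidity:
  fixes B :: "'a::euclidean_space \<Rightarrow> 'a \<Rightarrow> real" and T :: "'a \<Rightarrow> 'a"
  assumes B: "bounded_bilinear B" and comm: "\<And>x y. B x y = B y x"
    and nondeg: "\<And>x. (\<And>y. B x y = 0) \<Longrightarrow> x = 0"
    and S: "open S" "connected S" and x0: "x0 \<in> S" and T: "Ck_on 2 S T"
    and iso: "\<And>x u w. x \<in> S \<Longrightarrow>
      B (frechet_derivative T (at x) u) (frechet_derivative T (at x) w) = B u w"
  obtains L c where "linear L" and "\<And>u w. B (L u) (L w) = B u w"
    and "\<And>x. x \<in> S \<Longrightarrow> T x = L x + c"
proof -
  interpret B: bounded_bilinear B by fact
  define D where "D x = frechet_derivative T (at x)" for x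
  define D2 where "D2 x u v = frechet_derivative (\<lambda>y. D y u) (at x) v" for x u v
  have T2: "Ck_on (Suc (Suc 0)) S T" using T by (simp only: numeral_2_eq_2)
  have DT: "(T has_derivative D x) (at x)" if "x \<in> S" for x
    using Ck_on_SucD[OF T2 that] by (simp add: D_def)
  have D1: "Ck_on (Suc 0) S (\<lambda>y. D y u)" for u
    using T2 unfolding D_def by (auto simp only: Ck_on.simps)
  have DD: "((\<lambda>y. D y u) has_derivative D2 x u) (at x)" if "x \<in> S" for x u
    unfolding D2_def by (rule Ck_on_SucD[OF D1 that])
  have D2_zero: "D2 x u v = 0" if x: "x \<in> S" for x u v
  proof -
    have sym: "D2 x u v = D2 x v u" for u v
      unfolding D2_def D_def by (rule second_derivative_symmetric[OF S(1) x T])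
    have skew: "B (D2 x u v) (D x w) = - B (D2 x w v) (D x u)" for u v w
    proof -
      have "((\<lambda>y. B (D y u) (D y w)) has_derivative
          (\<lambda>v. B (D x u) (D2 x w v) + B (D2 x u v) (D x w))) (at x)"
        by (rule B.FDERIV[OF DD[OF x] DD[OF x]])
      moreover have "((\<lambda>y. B (D y u) (D y w)) has_derivative (\<lambda>v. 0)) (at x)"
        by (rule has_derivative_transform_within_open[OF has_derivative_const[of "B u w"] S(1) x])
          (simp add: D_def iso)
      ultimately have "B (D x u) (D2 x w v) + B (D2 x u v) (D x w) = 0"
        using has_derivative_unique by metis
      then show ?thesis using comm[of "D x u"] by simp
    qed
    \<comment> \<open>A cyclic shift changes the sign; three of them are the identity.\<close>
    have cyc: "B (D2 x u v) (D x w) = - B (D2 x v w) (D x u)" for u v w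
      using skew[of u v w] sym[of w v] by simp
    have tri: "B (D2 x u v) (D x w) = 0" for u v w
      using cyc[of u v w] cyc[of v w u] cyc[of w u v] by linarith
    have "bij (D x)"
    proof (rule isometry_bij[where B = B, OF B _ has_derivative_linear[OF DT[OF x]]])
      show "y = 0" if "\<And>z. B y z = 0" for y using that by (rule nondeg)
      show "B (D x u) (D x w) = B u w" for u w unfolding D_def by (rule iso[OF x])
    qed
    then have "B (D2 x u v) y = 0" for y
      using tri[of u v "inv_into UNIV (D x) y"] by (simp add: bij_is_surj surj_f_inv_f)
    then show ?thesis by (rule nondeg)
  qed
  have const: "D x u = D x0 u" if "x \<in> S" for x u
  proof (rule has_derivative_zero_unique_connected[OF S _ that x0])
    show "((\<lambda>y. D y u) has_derivative (\<lambda>v. 0)) (at y)" if "y \<in> S" for y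
    proof -
      have "D2 y u = (\<lambda>v. 0)" using D2_zero[OF that] by auto
      then show ?thesis using DD[OF that, of u] by simp
    qed
  qed
  have lin: "linear (D x0)" by (rule has_derivative_linear[OF DT[OF x0]])
  have rest: "T x - D x0 x = T x0 - D x0 x0" if "x \<in> S" for x
  proof (rule has_derivative_zero_unique_connected[OF S _ that x0])
    fix y assume y: "y \<in> S"
    have "((\<lambda>y. T y - D x0 y) has_derivative (\<lambda>v. D y v - D x0 v)) (at y)"
      by (intro has_derivative_diff DT y linear_imp_has_derivative lin)
    then show "((\<lambda>y. T y - D x0 y) has_derivative (\<lambda>v. 0)) (at y)"
      by (simp add: const[OF y])
  qed
  show thesis
  proof (rule that[OF lin])
    show "B (D x0 u) (D x0 w) = B u w" for u w unfolding D_def by (rule iso[OF x0])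
    show "T x = D x0 x + (T x0 - D x0 x0)" if "x \<in> S" for x
      using rest[OF that] by (simp add: algebra_simps)
  qed
qed

section \<open>Rigidity of isometries of the quadric\<close>

text \<open>
  The cone over \<open>upper J\<close> below. In this flat open set the metric is that of a cone with
  the radial coordinate \<open>radius J\<close> and the link \<open>upper J\<close>, so isometries of \<open>upper J\<close>
  extend to it.
\<close>

definition future_cone :: "'n::finite set \<Rightarrow> 'n amb set" where
  "future_cone J = {X. aform J X X < 0 \<and> alpha X > 0}"

definition upper :: "'n::finite set \<Rightarrow> 'n amb set" where
  "upper J = {X \<in> quadric J. alpha X > 0}"

definition radius :: "'n::finite set \<Rightarrow> 'n amb \<Rightarrow> real" where
  "radius J X = sqrt (- aform J X X)"

definition to_quadric :: "'n::finite set \<Rightarrow> 'n amb \<Rightarrow> 'n amb" where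
  "to_quadric J X = inverse (radius J X) *\<^sub>R X"

lemma open_alpha_pos: "open {X. alpha X > 0}"
  by (rule open_Collect_less) (auto simp: linear_continuous_on linear_alpha
      linear_conv_bounded_linear[THEN iffD1, OF linear_alpha] intro: continuous_intros)

lemma open_future_cone: "open (future_cone J)"
proof -
  have "open {X. aform J X X < 0}"
    by (rule open_Collect_less) (intro aform.continuous_on continuous_intros)+
  then show ?thesis using open_Int[OF _ open_alpha_pos] by (simp add: future_cone_def Collect_conj_eq)
qed

text \<open>
  For a form with several negative directions the cone is not convex. With the coordinates
  \<open>fst X\<close>, \<open>alpha X\<close> and \<open>- aform J X X\<close>, however, it becomes the product of a vector
  space and two half-lines.
\<close>

lemma connected_future_cone:
  fixes J :: "'n::finite set"
  shows "connected (future_cone J)"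
proof -
  define \<Psi> :: "(real^'n) \<times> real \<times> real \<Rightarrow> 'n amb" where
    "\<Psi> = (\<lambda>(v, a, c). (v, (a - (h J v + c) / a) / 2, (a + (h J v + c) / a) / 2))"
  have *: "alpha (\<Psi> (v, a, c)) = a" "aform J (\<Psi> (v, a, c)) (\<Psi> (v, a, c)) = - c"
    if "a > 0" for v a c
  proof -
    show al: "alpha (\<Psi> (v, a, c)) = a"
      by (simp add: \<Psi>_def alpha_def add_divide_distrib[symmetric])
    have "fst (snd (\<Psi> (v, a, c))) - snd (snd (\<Psi> (v, a, c))) = - (h J v + c) / a"
      using that by (simp add: \<Psi>_def field_simps)
    then show "aform J (\<Psi> (v, a, c)) (\<Psi> (v, a, c)) = - c"
      using that unfolding aform_split al by (simp add: \<Psi>_def)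
  qed
  have "future_cone J = \<Psi> ` (UNIV \<times> {0<..} \<times> {0<..})"
  proof (intro equalityI subsetI)
    fix X assume X: "X \<in> future_cone J"
    have "X = \<Psi> (fst X, alpha X, - aform J X X)"
      using X by (simp add: aform_split \<Psi>_def future_cone_def alpha_def prod_eq_iff)
    then show "X \<in> \<Psi> ` (UNIV \<times> {0<..} \<times> {0<..})"
      using X by (intro image_eqI) (auto simp: future_cone_def)
  next
    fix X assume "X \<in> \<Psi> ` (UNIV \<times> {0<..} \<times> {0<..})"
    then show "X \<in> future_cone J" using * by (auto simp: future_cone_def)
  qed
  moreover have "continuous_on (UNIV \<times> {0<..} \<times> {0<..}) \<Psi>"
    unfolding \<Psi>_def case_prod_unfold by (intro continuous_intros hform.continuous_on) auto
  moreover have "convex ((UNIV :: (real^'n) set) \<times> {0::real<..} \<times> {0::real<..})"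
    by (intro convex_Times convex_UNIV convex_real_interval)
  ultimately show ?thesis by (metis connected_continuous_image convex_connected)
qed

lemma upper_subset_future_cone: "upper J \<subseteq> future_cone J"
  by (auto simp: upper_def future_cone_def quadric_def)

lemma radius_pos: "X \<in> future_cone J \<Longrightarrow> radius J X > 0"
  by (simp add: future_cone_def radius_def)

lemma to_quadric_in_upper: "X \<in> future_cone J \<Longrightarrow> to_quadric J X \<in> upper J"
  using radius_pos[of X J]
  by (auto simp: upper_def to_quadric_def quadric_def future_cone_def aform.scaleR_left aform.scaleR_right
      radius_def field_simps)

lemma to_quadric_upper: "X \<in> upper J \<Longrightarrow> to_quadric J X = X"
  by (simp add: to_quadric_def radius_def upper_def quadric_def)

lemma radius_upper: "X \<in> upper J \<Longrightarrow> radius J X = 1"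
  by (simp add: radius_def upper_def quadric_def)

lemma radius_to_quadric: "X \<in> future_cone J \<Longrightarrow> radius J X *\<^sub>R to_quadric J X = X"
  using radius_pos[of X J] by (simp add: to_quadric_def)

lemma Ck_on_radius: "Ck_on k (future_cone J) (radius J)"
proof -
  have "Ck_on k (future_cone J) (\<lambda>X. aform J X X)"
    by (rule Ck_on_bilinear[OF bounded_bilinear_aform open_future_cone
          Ck_on_id[OF open_future_cone] Ck_on_id[OF open_future_cone]])
  then have neg: "Ck_on k (future_cone J) (\<lambda>X. - aform J X X)"
    by (rule Ck_on_linear_comp[OF linear_uminus open_future_cone])
  have "Ck_on k (future_cone J) (\<lambda>X. sqrt (- aform J X X))"
    by (rule Ck_on_compose[OF open_future_cone open_greaterThan _ Ck_on_sqrt neg])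
      (simp add: future_cone_def)
  then show ?thesis by (rule Ck_on_cong[OF open_future_cone, rotated]) (simp add: radius_def)
qed

lemma Ck_on_to_quadric: "Ck_on k (future_cone J) (to_quadric J)"
proof -
  have "Ck_on k (future_cone J) (\<lambda>X. inverse (radius J X))"
  proof (rule Ck_on_compose[OF open_future_cone _ _ Ck_on_inverse Ck_on_radius])
    show "open (- {0 :: real})" by (simp add: open_Compl)
    show "radius J X \<in> - {0}" if "X \<in> future_cone J" for X using radius_pos[OF that] by simp
  qed
  then have "Ck_on k (future_cone J) (\<lambda>X. inverse (radius J X) *\<^sub>R X)"
    by (rule Ck_on_scaleR[OF open_future_cone _ Ck_on_id[OF open_future_cone]])
  then show ?thesis by (rule Ck_on_cong[OF open_future_cone, rotated]) (simp add: to_quadric_def)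
qed

text \<open>
  Differentiate the equation of the quadric.
\<close>

lemma derivative_tangent:
  assumes "open V" and "x \<in> V" and quad: "\<And>y. y \<in> V \<Longrightarrow> f y \<in> quadric J"
    and f': "(f has_derivative f') (at x)"
  shows "aform J (f x) (f' u) = 0"
proof -
  have 1: "((\<lambda>y. aform J (f y) (f y)) has_derivative
      (\<lambda>u. aform J (f x) (f' u) + aform J (f' u) (f x))) (at x)"
    by (rule aform.FDERIV[OF f' f'])
  have "- 1 = aform J (f y) (f y)" if "y \<in> V" for y
    using quad[OF that] by (simp add: quadric_def)
  then have 2: "((\<lambda>y. aform J (f y) (f y)) has_derivative (\<lambda>v. 0)) (at x)"
    by (rule has_derivative_transform_within_open[OF has_derivative_const assms(1,2)])
  have "aform J (f x) (f' u) + aform J (f' u) (f x) = 0"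
    by (rule fun_cong[OF has_derivative_unique[OF 1 2]])
  then show ?thesis by (simp add: aform_commute[of J "f' u"])
qed

text \<open>
  The map \<open>\<tau>\<close> is only considered on \<open>upper J\<close>; its derivative is evaluated on an
  extension \<open>F\<close> to an open subset of the ambient space. Since the values of the derivative
  on tangent vectors do not depend on the extension, this says that \<open>\<tau>\<close> preserves the
  metric near the points of \<open>U\<close>.
\<close>

definition local_isometry :: "'n::finite set \<Rightarrow> 'n amb set \<Rightarrow> ('n amb \<Rightarrow> 'n amb) \<Rightarrow>
    ('n amb \<Rightarrow> 'n amb) \<Rightarrow> bool" where
  "local_isometry J U F \<tau> \<longleftrightarrow> open U \<and> Ck_on 2 U F \<and> (\<forall>Y\<in>U \<inter> upper J. F Y = \<tau> Y \<and>
     (\<forall>u\<in>quadric_tangent J Y. \<forall>w\<in>quadric_tangent J Y.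
        aform J (frechet_derivative F (at Y) u) (frechet_derivative F (at Y) w) = aform J u w))"

text \<open>
  The homogeneous extension \<open>T X = radius J X *\<^sub>R \<tau> (to_quadric J X)\<close> is an
  isometry of the flat cone: a vector splits into a radial and a tangential part, \<open>T\<close>
  keeps the length of the first and \<open>\<tau>\<close> that of the second, and both splittings are
  orthogonal. So \<open>flat_rigidity\<close> applies.
\<close>

lemma quadric_rigidity:
  fixes \<tau> :: "'n::finite amb \<Rightarrow> 'n amb"
  assumes maps: "\<And>X. X \<in> upper J \<Longrightarrow> \<tau> X \<in> upper J"
    and loc: "\<And>X. X \<in> upper J \<Longrightarrow> \<exists>U F. X \<in> U \<and> local_isometry J U F \<tau>"
  obtains L where "linear L" and "\<And>X Y. aform J (L X) (L Y) = aform J X Y"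
    and "\<And>X. X \<in> upper J \<Longrightarrow> \<tau> X = L X"
proof -
  define T where "T X = radius J X *\<^sub>R \<tau> (to_quadric J X)" for X
  have local: "\<exists>V. open V \<and> X \<in> V \<and> Ck_on 2 V T \<and> (\<forall>u w.
      aform J (frechet_derivative T (at X) u) (frechet_derivative T (at X) w) = aform J u w)"
    if X: "X \<in> future_cone J" for X
  proof -
    obtain U F where U: "to_quadric J X \<in> U" and F: "local_isometry J U F \<tau>"
      using loc[OF to_quadric_in_upper[OF X]] by blast
    define V where "V = future_cone J \<inter> to_quadric J -` U"
    have oU: "open U" and CF: "Ck_on 2 U F" using F by (auto simp: local_isometry_def)
    have "continuous_on (future_cone J) (to_quadric J)" using Ck_on_to_quadric[of 0 J] by simp
    then have V: "open V" "V \<subseteq> future_cone J"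
      using continuous_open_preimage[OF _ open_future_cone oU] by (auto simp: V_def)
    have XV: "X \<in> V" using X U by (simp add: V_def)
    have TF: "radius J Y *\<^sub>R F (to_quadric J Y) = T Y" and Fu: "F (to_quadric J Y) \<in> quadric J" if "Y \<in> V" for Y
    proof -
      have "to_quadric J Y \<in> U \<inter> upper J" using that to_quadric_in_upper[of Y J] by (simp add: V_def)
      then show "radius J Y *\<^sub>R F (to_quadric J Y) = T Y" "F (to_quadric J Y) \<in> quadric J"
        using F maps by (auto simp: T_def local_isometry_def upper_def)
    qed
    have "Ck_on 2 V (\<lambda>Y. radius J Y *\<^sub>R F (to_quadric J Y))"
      by (intro Ck_on_scaleR V(1) Ck_on_compose[OF V(1) oU _ CF]
          Ck_on_subset[OF Ck_on_radius V(2)] Ck_on_subset[OF Ck_on_to_quadric V(2)])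
        (simp add: V_def)
    then have CT: "Ck_on 2 V T" by (rule Ck_on_cong[OF V(1) TF, rotated])
    define r' where "r' = frechet_derivative (radius J) (at X)"
    define n' where "n' = frechet_derivative (to_quadric J) (at X)"
    define F' where "F' = frechet_derivative F (at (to_quadric J X))"
    have dr: "(radius J has_derivative r') (at X)" and dn: "(to_quadric J has_derivative n') (at X)"
      unfolding r'_def n'_def using Ck_on_SucD[OF Ck_on_radius X] Ck_on_SucD[OF Ck_on_to_quadric X] by auto
    have "(F has_derivative F') (at (to_quadric J X))"
      unfolding F'_def using CF U Ck_on_SucD[of "Suc 0" U F] by (simp add: numeral_2_eq_2)
    then have dF: "((\<lambda>Y. F (to_quadric J Y)) has_derivative (\<lambda>u. F' (n' u))) (at X)"
      by (rule has_derivative_compose[OF dn])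
    have dT: "frechet_derivative T (at X) u = radius J X *\<^sub>R F' (n' u) + r' u *\<^sub>R F (to_quadric J X)" for u
    proof -
      have "(T has_derivative (\<lambda>u. radius J X *\<^sub>R F' (n' u) + r' u *\<^sub>R F (to_quadric J X))) (at X)"
        by (rule has_derivative_transform_within_open[OF has_derivative_scaleR[OF dr dF] V(1) XV TF])
      from fun_cong[OF frechet_derivative_at[OF this]] show ?thesis by simp
    qed
    \<comment> \<open>The same product rule for the identity, that is, with \<open>F\<close> left out, splits \<open>u\<close> itself.\<close>
    have id: "u = radius J X *\<^sub>R n' u + r' u *\<^sub>R to_quadric J X" for u
    proof -
      have "((\<lambda>Y. Y) has_derivative (\<lambda>u. radius J X *\<^sub>R n' u + r' u *\<^sub>R to_quadric J X)) (at X)"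
        by (rule has_derivative_transform_within_open[OF has_derivative_scaleR[OF dr dn] open_future_cone X])
          (rule radius_to_quadric)
      from fun_cong[OF has_derivative_unique[OF has_derivative_ident this]] show ?thesis .
    qed
    have tn: "aform J (to_quadric J X) (n' u) = 0" for u
    proof (rule derivative_tangent[OF open_future_cone X _ dn])
      show "to_quadric J Y \<in> quadric J" if "Y \<in> future_cone J" for Y
        using to_quadric_in_upper[OF that] by (simp add: upper_def)
    qed
    have tF: "aform J (F (to_quadric J X)) (F' (n' u)) = 0" for u
      by (rule derivative_tangent[OF V(1) XV Fu dF])
    have nn: "aform J (to_quadric J X) (to_quadric J X) = - 1"
      using to_quadric_in_upper[OF X] by (simp add: upper_def quadric_def)
    have FF: "aform J (F (to_quadric J X)) (F (to_quadric J X)) = - 1"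
      using Fu[OF XV] by (simp add: quadric_def)
    have iso: "aform J (F' (n' u)) (F' (n' w)) = aform J (n' u) (n' w)" for u w
    proof -
      have "n' u \<in> quadric_tangent J (to_quadric J X)" "n' w \<in> quadric_tangent J (to_quadric J X)"
        by (simp_all add: quadric_tangent_def tn)
      moreover have "to_quadric J X \<in> U \<inter> upper J" using U to_quadric_in_upper[OF X] by blast
      ultimately show ?thesis using F unfolding local_isometry_def F'_def by blast
    qed
    have "aform J (frechet_derivative T (at X) u) (frechet_derivative T (at X) w) = aform J u w"
      for u w
    proof -
      have tn': "aform J (n' u) (to_quadric J X) = 0" for u
        using tn[of u] aform_commute[of J "n' u"] by simp
      have tF': "aform J (F' (n' u)) (F (to_quadric J X)) = 0" for u
        using tF[of u] aform_commute[of J "F' (n' u)"] by simp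
      have "aform J (frechet_derivative T (at X) u) (frechet_derivative T (at X) w) =
          radius J X * radius J X * aform J (n' u) (n' w) - r' u * r' w"
        by (simp add: dT aform.add_left aform.add_right aform.scaleR_left aform.scaleR_right
            iso tF tF' FF)
      moreover have "aform J u w = aform J (radius J X *\<^sub>R n' u + r' u *\<^sub>R to_quadric J X)
          (radius J X *\<^sub>R n' w + r' w *\<^sub>R to_quadric J X)"
        using arg_cong2[OF id[of u] id[of w], of "aform J"] .
      moreover have "\<dots> = radius J X * radius J X * aform J (n' u) (n' w) - r' u * r' w"
        by (simp add: aform.add_left aform.add_right aform.scaleR_left aform.scaleR_right
            tn tn' nn)
      ultimately show ?thesis by simp
    qed
    then show ?thesis using V(1) XV CT by blast
  qed
  \<comment> \<open>The additive constant is zero by homogeneity, tested on an arbitrary vector of the cone.\<close>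
  define E :: "'n amb" where "E = (0, 0, 1)"
  have E: "E \<in> future_cone J" "2 *\<^sub>R E \<in> future_cone J"
    by (simp_all add: future_cone_def E_def aform_def alpha_def hform.zero_left)
  have CT: "Ck_on 2 (future_cone J) T" using local by (intro Ck_on_local) blast
  obtain L c where L: "linear L" "\<And>X Y. aform J (L X) (L Y) = aform J X Y"
    and TL: "\<And>X. X \<in> future_cone J \<Longrightarrow> T X = L X + c"
  proof (rule flat_rigidity[where B = "aform J" and S = "future_cone J" and T = T,
        OF bounded_bilinear_aform aform_commute _ open_future_cone connected_future_cone E(1) CT])
    show "X = 0" if "\<And>Y. aform J X Y = 0" for X using that by (rule aform_nondegenerate)
    show "aform J (frechet_derivative T (at X) u) (frechet_derivative T (at X) w) = aform J u w"
      if "X \<in> future_cone J" for X u w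
      using local[OF that] by blast
  qed blast+
  have "radius J (2 *\<^sub>R E) = 2 * radius J E"
    by (simp add: radius_def aform.scaleR_left aform.scaleR_right real_sqrt_mult[symmetric]
        E_def aform_def hform.zero_left)
  then have "T (2 *\<^sub>R E) = 2 *\<^sub>R T E" by (simp add: T_def to_quadric_def)
  then have "c = 0"
    unfolding TL[OF E(1)] TL[OF E(2)] linear_scale[OF L(1)] by (simp add: scaleR_2 algebra_simps)
  moreover have "T X = \<tau> X" if "X \<in> upper J" for X
    using that by (simp add: T_def to_quadric_upper radius_upper)
  ultimately have "\<tau> X = L X" if "X \<in> upper J" for X
    using TL[of X] subsetD[OF upper_subset_future_cone that] that by simp
  then show thesis using that L by blast
qed


section \<open>The similarities of the half-space\<close>

definition sim :: "real \<Rightarrow> (real^'n \<Rightarrow> real^'n) \<Rightarrow> real^'n \<Rightarrow> 'n::finite half \<Rightarrow> 'n half" where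
  "sim r A v\<^sub>0 = restrict (\<lambda>(v, z). r *\<^sub>R (A v + v\<^sub>0, z)) half_space"

lemma G_half_sim: "G_half J = {sim r A v\<^sub>0 | r A v\<^sub>0. r > 0 \<and> A \<in> O_group J}"
  by (simp add: G_half_def sim_def)

lemma sim_apply: "z > 0 \<Longrightarrow> sim r A v\<^sub>0 (v, z) = (r *\<^sub>R (A v + v\<^sub>0), r * z)"
  by (simp add: sim_def half_space_def)

lemma half_space_iff: "(v, z) \<in> half_space \<longleftrightarrow> z > 0"
  by (simp add: half_space_def)

lemma open_half_space: "open half_space"
  unfolding half_space_def case_prod_unfold by (intro open_Collect_less continuous_intros)

lemma sim_in_half_space: "r > 0 \<Longrightarrow> a \<in> half_space \<Longrightarrow> sim r A v\<^sub>0 a \<in> half_space"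
  by (cases a) (simp add: sim_apply half_space_iff)

text \<open>
  The translation \<open>v1\<close> of the outer map is divided by the factor \<open>r2\<close> of the inner map,
  because a translation is applied before its map scales.
\<close>

lemma sim_compose:
  assumes "r2 > 0" and A1: "linear A1"
  shows "compose half_space (sim r1 A1 v1) (sim r2 A2 v2) =
    sim (r1 * r2) (A1 \<circ> A2) (A1 v2 + (1 / r2) *\<^sub>R v1)"
proof
  fix a :: "'a half"
  obtain v z where a: "a = (v, z)" by (cases a)
  show "compose half_space (sim r1 A1 v1) (sim r2 A2 v2) a =
      sim (r1 * r2) (A1 \<circ> A2) (A1 v2 + (1 / r2) *\<^sub>R v1) a"
  proof (cases "z > 0")
    case True
    then show ?thesis using assms(1)
      by (simp add: a compose_def half_space_iff sim_apply linear_add[OF A1] linear_scale[OF A1]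
          algebra_simps)
  next
    case False
    then show ?thesis by (simp add: a compose_def sim_def half_space_iff)
  qed
qed

lemma sim_id: "sim 1 id 0 = (\<lambda>a\<in>half_space. a)"
  by (auto simp: sim_def fun_eq_iff)

lemma sim_inverse:
  fixes A :: "real^'n::finite \<Rightarrow> real^'n" and v\<^sub>0 :: "real^'n"
  assumes "r > 0" and A: "A \<in> O_group J"
  defines "g' \<equiv> sim (1 / r) (inv_into UNIV A) (- r *\<^sub>R inv_into UNIV A v\<^sub>0)"
  shows "compose half_space g' (sim r A v\<^sub>0) = (\<lambda>a\<in>half_space. a)"
    and "compose half_space (sim r A v\<^sub>0) g' = (\<lambda>a\<in>half_space. a)"
proof -
  note lin = O_groupD(1)[OF A] O_groupD(1)[OF O_group_inv[OF A]]
  have bij: "bij A" by (rule O_groupD(2)[OF A])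
  have 1: "inv_into UNIV A \<circ> A = id" using bij by (simp add: bij_is_inj)
  have 2: "A \<circ> inv_into UNIV A = id" using bij by (simp add: bij_is_surj surj_iff[THEN iffD1])
  have 3: "A (inv_into UNIV A v\<^sub>0) = v\<^sub>0" using bij by (simp add: bij_is_surj surj_f_inv_f)
  show "compose half_space g' (sim r A v\<^sub>0) = (\<lambda>a\<in>half_space. a)"
    unfolding g'_def sim_compose[OF assms(1) lin(2)] 1 sim_id[symmetric] using assms(1) by simp
  have "1 / r > 0" using assms(1) by simp
  then show "compose half_space (sim r A v\<^sub>0) g' = (\<lambda>a\<in>half_space. a)"
    unfolding g'_def sim_compose[OF \<open>1 / r > 0\<close> lin(1)] 2 sim_id[symmetric]
    using assms(1) by (simp add: linear_scale[OF lin(1)] linear_neg[OF lin(1)] 3)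
qed

lemma G_half_inverse:
  assumes "g \<in> G_half J"
  obtains g' where "g' \<in> G_half J" and "compose half_space g' g = (\<lambda>a\<in>half_space. a)"
    and "compose half_space g g' = (\<lambda>a\<in>half_space. a)"
proof -
  obtain r A v\<^sub>0 where g: "g = sim r A v\<^sub>0" "r > 0" "A \<in> O_group J"
    using assms by (auto simp: G_half_sim)
  have "1 / r > 0" using g(2) by simp
  then have "sim (1 / r) (inv_into UNIV A) (- r *\<^sub>R inv_into UNIV A v\<^sub>0) \<in> G_half J"
    using O_group_inv[OF g(3)] unfolding G_half_sim by blast
  then show thesis using that sim_inverse[OF g(2,3)] g(1) by blast
qed

lemma G_half_maps: "g \<in> G_half J \<Longrightarrow> a \<in> half_space \<Longrightarrow> g a \<in> half_space"
  by (auto simp: G_half_sim intro: sim_in_half_space)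

lemma G_half_Bij:
  assumes g: "g \<in> G_half J"
  shows "g \<in> Bij half_space"
proof -
  obtain g' where g': "g' \<in> G_half J" "compose half_space g' g = (\<lambda>a\<in>half_space. a)"
      "compose half_space g g' = (\<lambda>a\<in>half_space. a)"
    using G_half_inverse[OF g] by blast
  have "g' (g a) = a" "g (g' a) = a" if "a \<in> half_space" for a
    using fun_cong[OF g'(2), of a] fun_cong[OF g'(3), of a] that by (simp_all add: compose_def)
  then have "bij_betw g half_space half_space"
    using G_half_maps[OF g] G_half_maps[OF g'(1)]
    by (intro bij_betw_byWitness[where f' = g']) auto
  moreover have "g \<in> extensional half_space"
    using g by (auto simp: G_half_sim sim_def)
  ultimately show ?thesis by (simp add: Bij_def)
qed

lemma G_half_compose:
  assumes "g \<in> G_half J" and "g' \<in> G_half J"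
  shows "compose half_space g g' \<in> G_half J"
proof -
  obtain r A v where g: "g = sim r A v" "r > 0" "A \<in> O_group J"
    using assms(1) by (auto simp: G_half_sim)
  obtain r' A' v' where g': "g' = sim r' A' v'" "r' > 0" "A' \<in> O_group J"
    using assms(2) by (auto simp: G_half_sim)
  have "r * r' > 0" using g(2) g'(2) by simp
  then show ?thesis
    unfolding g(1) g'(1) sim_compose[OF g'(2) O_groupD(1)[OF g(3)]] G_half_sim
    using O_group_comp[OF g(3) g'(3)] by blast
qed

lemma subgroup_G_half: "subgroup (G_half J) (BijGroup half_space)"
proof (rule subgroup.intro)
  show "G_half J \<subseteq> carrier (BijGroup half_space)"
    using G_half_Bij by (auto simp: BijGroup_def)
  show "g \<otimes>\<^bsub>BijGroup half_space\<^esub> g' \<in> G_half J" if "g \<in> G_half J" "g' \<in> G_half J" for g g'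
    using that G_half_compose[OF that] G_half_Bij[OF that(1)] G_half_Bij[OF that(2)]
    by (simp add: BijGroup_def)
  have "sim 1 id 0 \<in> G_half J" unfolding G_half_sim using O_group_id zero_less_one by blast
  then show "\<one>\<^bsub>BijGroup half_space\<^esub> \<in> G_half J" by (simp add: BijGroup_def sim_id)
  show "m_inv (BijGroup half_space) g \<in> G_half J" if g: "g \<in> G_half J" for g
  proof -
    obtain g' where g': "g' \<in> G_half J" "compose half_space g' g = (\<lambda>a\<in>half_space. a)"
      using G_half_inverse[OF g] by blast
    have "m_inv (BijGroup half_space) g = g'"
      using g' G_half_Bij[OF g] G_half_Bij[OF g'(1)]
      by (intro group.inv_equality[OF group_BijGroup]) (simp_all add: BijGroup_def)
    then show ?thesis using g' by simp
  qed
qed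

lemma sim_derivative:
  assumes "linear A" and "a \<in> half_space"
  shows "(sim r A v\<^sub>0 has_derivative (\<lambda>u. r *\<^sub>R (A (fst u), snd u))) (at a)"
proof -
  have "linear (\<lambda>u. r *\<^sub>R (A (fst u), snd u))"
    by (rule linearI) (simp_all add: linear_add[OF assms(1)] linear_scale[OF assms(1)] algebra_simps)
  then have "((\<lambda>u. r *\<^sub>R (A (fst u), snd u) + r *\<^sub>R (v\<^sub>0, 0)) has_derivative
      (\<lambda>u. r *\<^sub>R (A (fst u), snd u) + 0)) (at a)"
    by (intro has_derivative_add linear_imp_has_derivative has_derivative_const)
  then have "((\<lambda>u. r *\<^sub>R (A (fst u), snd u) + r *\<^sub>R (v\<^sub>0, 0)) has_derivative
      (\<lambda>u. r *\<^sub>R (A (fst u), snd u))) (at a)"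
    by simp
  then show ?thesis
    by (rule has_derivative_transform_within_open[OF _ open_half_space assms(2)])
      (auto simp: sim_def algebra_simps)
qed

lemma smooth_sim: "linear A \<Longrightarrow> smooth_on half_space (sim r A v\<^sub>0)"
  unfolding smooth_on_def
proof
  fix k assume A: "linear A"
  show "Ck_on k half_space (sim r A v\<^sub>0)"
  proof (rule Ck_on_SucE, rule Ck_on_SucI[OF open_half_space sim_derivative[OF A]])
    show "Ck_on k half_space (\<lambda>a. r *\<^sub>R (A (fst u), snd u))" for u
      by (rule Ck_on_const[OF open_half_space])
  qed
qed

lemma G_half_subset_Isom_half: "G_half J \<subseteq> Isom_half J"
proof
  fix g assume g: "g \<in> G_half J"
  obtain r A v\<^sub>0 where gs: "g = sim r A v\<^sub>0" and r: "r > 0" and A: "A \<in> O_group J"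
    using g by (auto simp: G_half_sim)
  obtain g' where g': "g' \<in> G_half J" "compose half_space g' g = (\<lambda>a\<in>half_space. a)"
      "compose half_space g g' = (\<lambda>a\<in>half_space. a)"
    using G_half_inverse[OF g] by blast
  have smooth: "smooth_on half_space f" if "f \<in> G_half J" for f
    using that unfolding G_half_sim by (auto intro: smooth_sim O_groupD(1))
  have bij: "bij_betw g half_space half_space" using G_half_Bij[OF g] by (simp add: Bij_def)
  have inv: "g' a = inv_into half_space g a" if "a \<in> half_space" for a
  proof -
    have "g (g' a) = a" using fun_cong[OF g'(3), of a] that by (simp add: compose_def)
    then show ?thesis
      using inv_into_f_f[OF bij_betw_imp_inj_on[OF bij] G_half_maps[OF g'(1) that]] by simp
  qed
  have "smooth_on half_space (inv_into half_space g)"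
    unfolding smooth_on_def
  proof
    fix k
    have "Ck_on k half_space g'" using smooth[OF g'(1)] by (simp add: smooth_on_def)
    then show "Ck_on k half_space (inv_into half_space g)"
      by (rule Ck_on_cong[OF open_half_space, rotated]) (rule inv)
  qed
  moreover have "half_metric J (g a) (frechet_derivative g (at a) u) (frechet_derivative g (at a) w)
      = half_metric J a u w" if a: "a \<in> half_space" for a u w
  proof -
    have D: "frechet_derivative g (at a) = (\<lambda>u. r *\<^sub>R (A (fst u), snd u))"
      unfolding gs
      by (rule frechet_derivative_at[OF sim_derivative[OF O_groupD(1)[OF A] a], symmetric])
    obtain v z where "a = (v, z)" "z > 0" using a by (auto simp: half_space_def)
    then show ?thesis using r unfolding half_metric_def D
      by (simp add: gs sim_apply hform.scaleR_left hform.scaleR_right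
          O_groupD(3)[OF A] field_simps power2_eq_square)
  qed
  ultimately show "g \<in> Isom_half J"
    using smooth[OF g] G_half_Bij[OF g] by (simp add: Isom_half_def)
qed


section \<open>Similarities as linear isometries\<close>

text \<open>
  The image is prescribed by \<open>fst = A (fst X) + alpha X *\<^sub>R v\<^sub>0\<close> and
  \<open>alpha = alpha X / r\<close>, which is the similarity in the chart; \<open>b\<close> is the remaining
  coordinate \<open>fst (snd Y) - snd (snd Y)\<close> of the image \<open>Y\<close>, solved from the condition that
  the form is preserved.
\<close>

definition lift_sim :: "'n::finite set \<Rightarrow> real \<Rightarrow> (real^'n \<Rightarrow> real^'n) \<Rightarrow> real^'n \<Rightarrow> 'n amb \<Rightarrow> 'n amb"
  where "lift_sim J r A v\<^sub>0 X =
    (let b = r * (fst (snd X) - snd (snd X) - 2 * hform J (A (fst X)) v\<^sub>0 - alpha X * h J v\<^sub>0)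
     in (A (fst X) + alpha X *\<^sub>R v\<^sub>0, (alpha X / r + b) / 2, (alpha X / r - b) / 2))"

lemma alpha_lift_sim: "alpha (lift_sim J r A v\<^sub>0 X) = alpha X / r"
  by (simp add: lift_sim_def Let_def alpha_def[of "(_, _)"] add_divide_distrib[symmetric])

lemma linear_lift_sim:
  assumes "linear A" shows "linear (lift_sim J r A v\<^sub>0)"
  by (rule linearI)
    (simp_all add: lift_sim_def Let_def linear_add[OF assms] linear_scale[OF assms] hform.add_left
      hform.scaleR_left algebra_simps add_divide_distrib diff_divide_distrib)

lemma aform_lift_sim:
  assumes "r > 0" and A: "A \<in> O_group J"
  shows "aform J (lift_sim J r A v\<^sub>0 X) (lift_sim J r A v\<^sub>0 X) = aform J X X"
proof -
  let ?Y = "lift_sim J r A v\<^sub>0 X"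
  have "fst (snd ?Y) - snd (snd ?Y) =
      r * (fst (snd X) - snd (snd X) - 2 * hform J (A (fst X)) v\<^sub>0 - alpha X * h J v\<^sub>0)"
    by (simp add: lift_sim_def Let_def diff_divide_distrib[symmetric])
  then have diff: "alpha X / r * (fst (snd ?Y) - snd (snd ?Y)) =
      alpha X * (fst (snd X) - snd (snd X) - 2 * hform J (A (fst X)) v\<^sub>0 - alpha X * h J v\<^sub>0)"
    using assms(1) by (simp del: mult_eq_0_iff)
  have "h J (fst ?Y) =
      h J (fst X) + 2 * alpha X * hform J (A (fst X)) v\<^sub>0 + alpha X * alpha X * h J v\<^sub>0"
    using hform_commute[of J v\<^sub>0 "A (fst X)"]
    by (simp add: lift_sim_def Let_def hform.add_left hform.add_right hform.scaleR_left
        hform.scaleR_right O_groupD(3)[OF A] algebra_simps)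
  then show ?thesis
    unfolding aform_split alpha_lift_sim diff by (simp add: algebra_simps)
qed

lemma lift_sim_lift_pt:
  assumes "r > 0" and A: "A \<in> O_group J" and "a \<in> half_space"
  shows "lift_sim J r A v\<^sub>0 (lift_pt J a) = lift_pt J (sim r A v\<^sub>0 a)"
proof -
  obtain v z where a: "a = (v, z)" "z > 0" using assms(3) by (auto simp: half_space_def)
  note lin = O_groupD(1)[OF A]
  show ?thesis
  proof (rule quadric_eqI)
    show "lift_sim J r A v\<^sub>0 (lift_pt J a) \<in> quadric J"
      using lift_pt_in_quadric[of z J v] a aform_lift_sim[OF assms(1) A]
      by (simp add: quadric_def)
    show "lift_pt J (sim r A v\<^sub>0 a) \<in> quadric J"
      using a assms(1) by (simp add: sim_apply lift_pt_in_quadric)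
    show "fst (lift_sim J r A v\<^sub>0 (lift_pt J a)) = fst (lift_pt J (sim r A v\<^sub>0 a))"
      using a assms(1) by (simp add: lift_sim_def Let_def fst_lift_pt alpha_lift_pt sim_apply
          linear_scale[OF lin] scaleR_add_right)
    show "alpha (lift_sim J r A v\<^sub>0 (lift_pt J a)) = alpha (lift_pt J (sim r A v\<^sub>0 a))"
      using a by (simp add: alpha_lift_sim alpha_lift_pt sim_apply mult.commute)
    show "alpha (lift_sim J r A v\<^sub>0 (lift_pt J a)) \<noteq> 0"
      using a assms(1) by (simp add: alpha_lift_sim alpha_lift_pt)
  qed
qed

section \<open>Linear isometries as similarities\<close>

text \<open>
  Such an \<open>X\<close> is a limit of points \<open>X + t *\<^sub>R (0, 0, 1)\<close> of the cone.
\<close>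

lemma alpha_pos_limit:
  fixes J :: "'n::finite set"
  assumes L: "linear L" and "\<And>X. X \<in> future_cone J \<Longrightarrow> alpha (L X) > 0"
    and X: "aform J X X < 0" "alpha X = 0"
  shows "alpha (L X) \<ge> 0"
proof -
  define E :: "'n amb" where "E = (0, 0, 1)"
  have E: "aform J E E = - 1" "alpha E = 1"
    by (simp_all add: E_def aform_def alpha_def hform.zero_left)
  have "((\<lambda>t. aform J (X + t *\<^sub>R E) (X + t *\<^sub>R E)) \<longlongrightarrow>
      aform J (X + 0 *\<^sub>R E) (X + 0 *\<^sub>R E)) (at_right 0)"
    by (intro aform.tendsto tendsto_intros)
  then have "eventually (\<lambda>t. aform J (X + t *\<^sub>R E) (X + t *\<^sub>R E) < 0) (at_right 0)"
    using X(1) by (simp add: order_tendstoD(2))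
  then have "eventually (\<lambda>t. alpha (L X) + t * alpha (L E) \<ge> 0) (at_right 0)"
    using eventually_at_right_less[of 0]
  proof eventually_elim
    case (elim t)
    then have "X + t *\<^sub>R E \<in> future_cone J" using X(2) E(2) by (simp add: future_cone_def)
    from assms(2)[OF this] show ?case
      by (simp add: linear_add[OF L] linear_scale[OF L])
  qed
  moreover have "((\<lambda>t. alpha (L X) + t * alpha (L E)) \<longlongrightarrow> alpha (L X) + 0 * alpha (L E)) (at_right 0)"
    by (intro tendsto_intros)
  ultimately show ?thesis
    using tendsto_lowerbound by fastforce
qed

text \<open>
  On negative vectors of the kernel the limit argument applies to \<open>X\<close> and to \<open>- X\<close>. These
  vectors span the kernel: adding a large multiple of a negative basis vector, which
  exists because \<open>J\<close> is not empty, makes every vector negative.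
\<close>

lemma alpha_kernel_preserved:
  fixes J :: "'n::finite set"
  assumes L: "linear L" and pos: "\<And>X. X \<in> future_cone J \<Longrightarrow> alpha (L X) > 0" and "J \<noteq> {}"
    and X: "alpha X = 0"
  shows "alpha (L X) = 0"
proof -
  have neg: "alpha (L Y) = 0" if "aform J Y Y < 0" "alpha Y = 0" for Y
    using alpha_pos_limit[OF L pos that] alpha_pos_limit[OF L pos, of J "- Y"] that
    by (simp add: linear_neg[OF L] aform.minus_left aform.minus_right)
  obtain j where j: "j \<in> J" using assms(3) by blast
  define e :: "'n amb" where "e = (axis j 1, 0, 0)"
  have e: "aform J e e = - 1" "alpha e = 0"
    using j by (simp_all add: e_def aform_def alpha_def hform_axis)
  define m where "m = aform J X e"
  \<comment> \<open>Large enough for the term \<open>- t\<^sup>2\<close> to dominate the other two.\<close>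
  define t where "t = \<bar>aform J X X\<bar> + 2 * \<bar>m\<bar> + 1"
  have t: "t \<ge> 1" by (simp add: t_def)
  have "aform J (X + t *\<^sub>R e) (X + t *\<^sub>R e) = aform J X X + 2 * t * m - t * t"
    using e(1) aform_commute[of J e X]
    by (simp add: aform.add_left aform.add_right aform.scaleR_left aform.scaleR_right m_def
        algebra_simps)
  also have "\<dots> = aform J X X + t * (2 * m - t)" by (simp add: algebra_simps)
  also have "\<dots> \<le> aform J X X + t * (- (\<bar>aform J X X\<bar> + 1))"
    using t by (intro add_left_mono mult_left_mono) (auto simp: t_def)
  also have "\<dots> \<le> aform J X X + 1 * (- (\<bar>aform J X X\<bar> + 1))"
    using t by (intro add_left_mono mult_right_mono_neg) auto
  also have "\<dots> < 0" by simp
  finally have "alpha (L (X + t *\<^sub>R e)) = 0" using X e(2) by (intro neg) simp_all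
  moreover have "alpha (L e) = 0" using e by (intro neg) simp_all
  ultimately show ?thesis by (simp add: linear_add[OF L] linear_scale[OF L])
qed

text \<open>
  Since \<open>L\<close> preserves the kernel of \<open>alpha\<close>, it multiplies \<open>alpha\<close> by a constant \<open>c > 0\<close>
  and, being an isometry, \<open>null_vec\<close> by \<open>1 / c\<close>. The quadratic terms of \<open>lift_pt J (v, z)\<close>
  occur only in the direction of \<open>null_vec\<close>, so they do not contribute to \<open>fst\<close> of the
  image, which is therefore affine in \<open>v\<close>.
\<close>

lemma cone_isometry_is_similarity:
  fixes J :: "'n::finite set"
  assumes L: "linear L" and iso: "\<And>X Y. aform J (L X) (L Y) = aform J X Y"
    and up: "\<And>X. X \<in> upper J \<Longrightarrow> L X \<in> upper J" and "J \<noteq> {}"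
  obtains g where "g \<in> G_half J" and "\<And>a. a \<in> half_space \<Longrightarrow> L (lift_pt J a) = lift_pt J (g a)"
proof -
  have pos: "alpha (L X) > 0" if X: "X \<in> future_cone J" for X
  proof -
    have "alpha (L (to_quadric J X)) > 0" using up[OF to_quadric_in_upper[OF X]] by (simp add: upper_def)
    then have "radius J X * alpha (L (to_quadric J X)) > 0" using radius_pos[OF X] by simp
    then show ?thesis
      using arg_cong[OF radius_to_quadric[OF X], of "\<lambda>X. alpha (L X)"] by (simp add: linear_scale[OF L])
  qed
  have ker: "alpha (L X) = 0" if "alpha X = 0" for X
    using that by (intro alpha_kernel_preserved[OF L _ \<open>J \<noteq> {}\<close>]) (rule pos)
  \<comment> \<open>Spans a complement of the kernel of \<open>alpha\<close>; it is the constant term of the numerator of \<open>lift_pt\<close>.\<close>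
  define E :: "'n amb" where "E = (0, 1 / 2, 1 / 2)"
  have aE: "alpha E = 1" by (simp add: E_def alpha_def)
  define c where "c = alpha (L E)"
  have alpha_L: "alpha (L X) = c * alpha X" for X
  proof -
    have "alpha (L (X - alpha X *\<^sub>R E)) = 0" by (rule ker) (simp add: aE)
    then show ?thesis by (simp add: linear_diff[OF L] linear_scale[OF L] c_def)
  qed
  have "(0, 0, 1) \<in> future_cone J" by (simp add: future_cone_def aform_def alpha_def hform.zero_left)
  from pos[OF this] have c: "c > 0" unfolding alpha_L by (simp add: alpha_def)
  have "L null_vec = (1 / c) *\<^sub>R null_vec"
  proof -
    have "aform J (L null_vec - (1 / c) *\<^sub>R null_vec) Y = 0" for Y
    proof -
      have "bij L" by (rule aform_isometry_bij[OF L iso])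
      then obtain Z where Y: "Y = L Z" by (meson bij_pointE)
      show ?thesis using c
        by (simp add: Y aform.diff_left aform.scaleR_left iso aform_null_vec alpha_L)
    qed
    then have "L null_vec - (1 / c) *\<^sub>R null_vec = 0" by (rule aform_nondegenerate)
    then show ?thesis by simp
  qed
  then have fst_null: "fst (L null_vec) = 0" by (simp add: null_vec_def)
  define A where "A v = fst (L (v, 0, 0))" for v
  define v\<^sub>0 where "v\<^sub>0 = fst (L E)"
  have A: "A \<in> O_group J"
    unfolding O_group_def mem_Collect_eq
  proof (intro conjI allI)
    have add: "L (v + w, 0, 0) = L (v, 0, 0) + L (w, 0, 0)" for v w
      using linear_add[OF L, of "(v, 0, 0)" "(w, 0, 0)"] by simp
    have scale: "L (t *\<^sub>R v, 0, 0) = t *\<^sub>R L (v, 0, 0)" for t v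
      using linear_scale[OF L, of t "(v, 0, 0)"] by simp
    show "linear A" by (rule linearI) (simp_all add: A_def add scale)
    fix v
    have "alpha (L (v, 0, 0)) = 0" using alpha_L[of "(v, 0, 0)"] by (simp add: alpha_def[of "(v, 0, 0)"])
    then have "h J (A v) = aform J (L (v, 0, 0)) (L (v, 0, 0))"
      by (simp add: aform_split A_def)
    then show "h J (A v) = h J v" by (simp add: iso aform_def[of J "(v, 0, 0)"])
  qed
  have "L (lift_pt J a) = lift_pt J (sim (1 / c) A v\<^sub>0 a)" if a_in: "a \<in> half_space" for a
  proof -
    obtain v z where a: "a = (v, z)" "z > 0" using a_in by (auto simp: half_space_def)
    have lift_pt: "lift_pt J a = (1 / z) *\<^sub>R ((v, 0, 0) + E - ((h J v + z\<^sup>2) / 2) *\<^sub>R null_vec)"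
      using a by (simp add: lift_pt_def E_def null_vec_def field_simps)
    have fst_L: "fst (L (lift_pt J a)) = (1 / z) *\<^sub>R (A v + v\<^sub>0)"
      unfolding lift_pt linear_scale[OF L] linear_add[OF L] linear_diff[OF L]
      by (simp add: fst_null A_def v\<^sub>0_def)
    show ?thesis
    proof (rule quadric_eqI)
      show "L (lift_pt J a) \<in> quadric J"
        using lift_pt_in_quadric[of z J v] a iso by (simp add: quadric_def)
      show "lift_pt J (sim (1 / c) A v\<^sub>0 a) \<in> quadric J"
        using a c by (simp add: sim_apply lift_pt_in_quadric)
      show "fst (L (lift_pt J a)) = fst (lift_pt J (sim (1 / c) A v\<^sub>0 a))"
        unfolding fst_L using a c by (simp add: sim_apply fst_lift_pt)
      show "alpha (L (lift_pt J a)) = alpha (lift_pt J (sim (1 / c) A v\<^sub>0 a))"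
        using a c by (simp add: alpha_L sim_apply alpha_lift_pt)
      show "alpha (L (lift_pt J a)) \<noteq> 0" using a c by (simp add: alpha_L alpha_lift_pt)
    qed
  qed
  moreover have "sim (1 / c) A v\<^sub>0 \<in> G_half J"
    unfolding G_half_sim using A c by (metis (mono_tags, lifting) mem_Collect_eq zero_less_divide_1_iff)
  ultimately show thesis using that by blast
qed

text \<open>
  The common core of both converses: what remains for each of them is to present the given
  isometry as a map of \<open>upper J\<close>.
\<close>

lemma upper_rigidity:
  fixes \<tau> :: "'n::finite amb \<Rightarrow> 'n amb"
  assumes "J \<noteq> {}" and maps: "\<And>X. X \<in> upper J \<Longrightarrow> \<tau> X \<in> upper J"
    and loc: "\<And>X. X \<in> upper J \<Longrightarrow> \<exists>U F. X \<in> U \<and> local_isometry J U F \<tau>"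
  obtains g where "g \<in> G_half J" and "\<And>a. a \<in> half_space \<Longrightarrow> \<tau> (lift_pt J a) = lift_pt J (g a)"
proof -
  obtain L where L: "linear L" "\<And>X Y. aform J (L X) (L Y) = aform J X Y"
    and \<tau>L: "\<And>X. X \<in> upper J \<Longrightarrow> \<tau> X = L X"
    using quadric_rigidity[OF maps loc] by blast
  obtain g where g: "g \<in> G_half J" "\<And>a. a \<in> half_space \<Longrightarrow> L (lift_pt J a) = lift_pt J (g a)"
    using cone_isometry_is_similarity[OF L _ assms(1)] maps \<tau>L by metis
  have "lift_pt J a \<in> upper J" if "a \<in> half_space" for a
    using that by (cases a) (auto simp: upper_def lift_pt_in_quadric alpha_lift_pt half_space_iff)
  then show thesis using that g \<tau>L by metis
qed


section \<open>The isometries of the half-space\<close>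

text \<open>
  The derivative of \<open>lift_pt J\<close> at \<open>a\<close>, in the shape that the quotient rule gives it: the
  first summand comes from the numerator, the second one from the denominator \<open>snd a\<close>.
\<close>

definition lift_pt_deriv :: "'n::finite set \<Rightarrow> 'n half \<Rightarrow> 'n half \<Rightarrow> 'n amb" where
  "lift_pt_deriv J a u = (1 / snd a) *\<^sub>R
      ((fst u, 0, 0) - (hform J (fst a) (fst u) + snd a * snd u) *\<^sub>R null_vec)
    - (snd u / snd a) *\<^sub>R lift_pt J a"

text \<open>
  The numerator lies in the affine hyperplane \<open>alpha = 1\<close> and is quadratic only in the
  direction of \<open>null_vec\<close>.
\<close>

lemma lift_pt_eq:
  assumes "snd a \<noteq> 0"
  shows "lift_pt J a = inverse (snd a) *\<^sub>R ((fst a, 1 / 2, 1 / 2) -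
    ((hform J (fst a) (fst a) + snd a * snd a) / 2) *\<^sub>R null_vec)"
  using assms by (cases a) (simp add: lift_pt_def null_vec_def field_simps power2_eq_square)

lemma lift_pt_has_derivative:
  fixes a :: "'n::finite half"
  assumes a: "a \<in> half_space"
  shows "(lift_pt J has_derivative lift_pt_deriv J a) (at a)"
proof -
  define E :: "'n half \<Rightarrow> 'n amb" where "E b = (fst b, 1 / 2, 1 / 2) -
    ((hform J (fst b) (fst b) + snd b * snd b) / 2) *\<^sub>R null_vec" for b
  have z: "snd a > 0" using a by (auto simp: half_space_def)
  have lift_pt: "inverse (snd b) *\<^sub>R E b = lift_pt J b" if "b \<in> half_space" for b
    using that by (subst lift_pt_eq) (auto simp: half_space_def E_def)
  have l: "((\<lambda>b :: 'n half. (fst b, 1 / 2 :: real, 1 / 2 :: real)) has_derivative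
      (\<lambda>u. (fst u, 0, 0))) (at a)"
    by (intro has_derivative_Pair has_derivative_fst has_derivative_ident has_derivative_const)
  have f: "((\<lambda>b :: 'n half. fst b) has_derivative fst) (at a)"
    and s: "((\<lambda>b :: 'n half. snd b) has_derivative snd) (at a)"
    by (intro has_derivative_fst has_derivative_snd has_derivative_ident)+
  have q: "((\<lambda>b. (hform J (fst b) (fst b) + snd b * snd b) / 2) has_derivative
      (\<lambda>u. ((hform J (fst a) (fst u) + hform J (fst u) (fst a)) + (snd a * snd u + snd u * snd a)) / 2))
      (at a)"
    by (intro bounded_linear.has_derivative[OF bounded_linear_divide] has_derivative_add hform.FDERIV[OF f f]
        has_derivative_mult[OF s s])
  have q': "(\<lambda>u. ((hform J (fst a) (fst u) + hform J (fst u) (fst a)) +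
      (snd a * snd u + snd u * snd a)) / 2) =
      (\<lambda>u. hform J (fst a) (fst u) + snd a * snd u)"
    by (rule ext) (simp add: hform_commute[of J _ "fst a"] add_divide_distrib)
  have "((\<lambda>b. (hform J (fst b) (fst b) + snd b * snd b) / 2) has_derivative
      (\<lambda>u. hform J (fst a) (fst u) + snd a * snd u)) (at a)"
    using q unfolding q' .
  then have E: "(E has_derivative (\<lambda>u. (fst u, 0, 0) -
      (hform J (fst a) (fst u) + snd a * snd u) *\<^sub>R null_vec)) (at a)"
    unfolding E_def by (intro has_derivative_diff l has_derivative_scaleR_left)
  have i: "((\<lambda>b :: 'n half. inverse (snd b)) has_derivative
      (\<lambda>u. - (inverse (snd a) * snd u * inverse (snd a)))) (at a)"
    using z by (intro Deriv.has_derivative_inverse[OF _ s]) simp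
  have "((\<lambda>b. inverse (snd b) *\<^sub>R E b) has_derivative
      (\<lambda>u. inverse (snd a) *\<^sub>R ((fst u, 0, 0) -
        (hform J (fst a) (fst u) + snd a * snd u) *\<^sub>R null_vec) +
        (- (inverse (snd a) * snd u * inverse (snd a))) *\<^sub>R E a)) (at a)"
    by (rule has_derivative_scaleR[OF i E])
  moreover have "(\<lambda>u. inverse (snd a) *\<^sub>R ((fst u, 0, 0) -
        (hform J (fst a) (fst u) + snd a * snd u) *\<^sub>R null_vec) +
        (- (inverse (snd a) * snd u * inverse (snd a))) *\<^sub>R E a) = lift_pt_deriv J a"
    unfolding lift_pt_deriv_def lift_pt[OF a, symmetric] divide_inverse
    by (rule ext) (simp only: scaleR_minus_left scaleR_scaleR mult_1_left mult.commute
        add_uminus_conv_diff mult.left_commute mult.assoc)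
  ultimately have "((\<lambda>b. inverse (snd b) *\<^sub>R E b) has_derivative lift_pt_deriv J a) (at a)"
    by (rule has_derivative_eq_rhs)
  then show ?thesis
    by (rule has_derivative_transform_within_open[OF _ open_half_space a]) (rule lift_pt)
qed

lemma lift_pt_isometric:
  assumes a: "a \<in> half_space"
  shows "aform J (lift_pt_deriv J a u) (lift_pt_deriv J a w) = half_metric J a u w"
proof -
  obtain v z where vz: "a = (v, z)" "z > 0" using a by (auto simp: half_space_def)
  define E :: "'a half \<Rightarrow> 'a amb"
    where "E u = (fst u, 0, 0) - (hform J v (fst u) + z * snd u) *\<^sub>R null_vec" for u
  have s': "lift_pt_deriv J a u = (1 / z) *\<^sub>R (E u - snd u *\<^sub>R lift_pt J a)" for u
    by (simp add: lift_pt_deriv_def E_def vz(1) scaleR_diff_right)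
  have EE: "aform J (E u) (E w) = hform J (fst u) (fst w)" for u w
    by (simp add: E_def aform_def null_vec_def algebra_simps)
  have Es: "aform J (E u) (lift_pt J a) = - snd u" for u
  proof -
    have "aform J (E u) (lift_pt J a) = hform J (fst u) v / z -
        (hform J v (fst u) + z * snd u) * alpha (lift_pt J a)"
      by (simp add: E_def aform_def null_vec_def alpha_def vz fst_lift_pt hform.scaleR_right
          algebra_simps)
    then show ?thesis
      using vz hform_commute[of J "fst u" v] by (simp add: alpha_lift_pt add_divide_distrib)
  qed
  have ss: "aform J (lift_pt J a) (lift_pt J a) = - 1"
    using lift_pt_in_quadric[of z J v] vz by (simp add: quadric_def)
  have "aform J (E u - snd u *\<^sub>R lift_pt J a) (E w - snd w *\<^sub>R lift_pt J a) =
      hform J (fst u) (fst w) + snd u * snd w"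
    using Es[of u] Es[of w] aform_commute[of J "lift_pt J a" "E w"]
    by (simp add: aform.diff_left aform.diff_right aform.scaleR_left aform.scaleR_right EE ss)
  then show ?thesis
    unfolding s' aform.scaleR_left aform.scaleR_right half_metric_def
    by (simp add: vz(1) power2_eq_square)
qed

lemma Ck_on_lift_pt: "Ck_on k half_space (lift_pt J)"
proof -
  note op = open_half_space
  have fst: "Ck_on k half_space (\<lambda>a. fst a)" and snd: "Ck_on k half_space (\<lambda>a. snd a)"
    by (simp_all add: Ck_on_linear linear_fst linear_snd op)
  have l: "Ck_on k half_space (\<lambda>a. (fst a, 1 / 2, 1 / 2 :: real) :: _ \<times> real \<times> real)"
    by (rule Ck_on_Pair[OF op fst Ck_on_const[OF op]])
  have q: "Ck_on k half_space (\<lambda>a. hform J (fst a) (fst a) + snd a * snd a)"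
    by (intro Ck_on_add op Ck_on_bilinear[OF bounded_bilinear_hform op fst fst]
        Ck_on_mult_real[OF op snd snd])
  have i: "Ck_on k half_space (\<lambda>a. inverse (snd a))"
  proof (rule Ck_on_compose[OF op _ _ Ck_on_inverse snd])
    show "open (- {0 :: real})" by (simp add: open_Compl)
    show "snd a \<in> - {0}" if "a \<in> half_space" for a using that by (auto simp: half_space_def)
  qed
  have "Ck_on k half_space (\<lambda>a. inverse (snd a) *\<^sub>R ((fst a, 1 / 2, 1 / 2) +
      (hform J (fst a) (fst a) + snd a * snd a) *\<^sub>R ((- 1 / 2) *\<^sub>R null_vec)))"
    by (rule Ck_on_scaleR[OF op i Ck_on_add[OF op l Ck_on_scaleR[OF op q Ck_on_const[OF op]]]])
  moreover have "inverse (snd a) *\<^sub>R ((fst a, 1 / 2, 1 / 2) +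
      (hform J (fst a) (fst a) + snd a * snd a) *\<^sub>R ((- 1 / 2) *\<^sub>R null_vec)) = lift_pt J a"
    if "a \<in> half_space" for a
  proof -
    have "snd a \<noteq> 0" using that by (auto simp: half_space_def)
    from lift_pt_eq[OF this, of J] show ?thesis by simp
  qed
  ultimately show ?thesis by (rule Ck_on_cong[OF op, rotated])
qed

lemma Ck_on_chart: "Ck_on k {X. alpha X > 0} chart"
proof -
  note op = open_alpha_pos
  have "Ck_on k {X. alpha X > 0} (\<lambda>X :: 'a amb. inverse (alpha X))"
  proof (rule Ck_on_compose[OF op _ _ Ck_on_inverse Ck_on_linear[OF linear_alpha op]])
    show "open (- {0 :: real})" by (simp add: open_Compl)
  qed auto
  then have "Ck_on k {X. alpha X > 0} (\<lambda>X :: 'a amb. inverse (alpha X) *\<^sub>R (fst X, 1 :: real))"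
    by (rule Ck_on_scaleR[OF op _ Ck_on_Pair[OF op Ck_on_linear[OF linear_fst op] Ck_on_const[OF op]]])
  then show ?thesis
    by (rule Ck_on_cong[OF op, rotated]) (simp add: chart_def inverse_eq_divide)
qed

text \<open>
  The retraction \<open>lift_pt J \<circ> chart\<close> of the ambient half-space \<open>alpha > 0\<close> onto
  \<open>upper J\<close> keeps \<open>fst\<close> and \<open>alpha\<close>, so its derivative changes a vector only by a multiple
  of \<open>null_vec\<close>; if both vectors are tangent to the quadric, this multiple is zero because
  \<open>alpha Y > 0\<close>.
\<close>

lemma lift_pt_chart_tangent:
  assumes Y: "Y \<in> upper J" and u: "u \<in> quadric_tangent J Y"
    and p: "(chart has_derivative p') (at Y)"
  shows "lift_pt_deriv J (chart Y) (p' u) = u"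
proof -
  let ?U = "{X :: 'a amb. alpha X > 0}"
  have YU: "Y \<in> ?U" and YQ: "Y \<in> quadric J" using Y by (auto simp: upper_def)
  have d: "((\<lambda>X. lift_pt J (chart X)) has_derivative (\<lambda>u. lift_pt_deriv J (chart Y) (p' u))) (at Y)"
    by (rule has_derivative_compose[OF p lift_pt_has_derivative[OF chart_in_half_space]])
      (use YU in simp)
  have R: "fst X = fst (lift_pt J (chart X))" "alpha X = alpha (lift_pt J (chart X))"
      "lift_pt J (chart X) \<in> quadric J" if "X \<in> ?U" for X
    using that by (simp_all add: chart_def fst_lift_pt alpha_lift_pt lift_pt_in_quadric)
  have "(fst has_derivative (\<lambda>u. fst (lift_pt_deriv J (chart Y) (p' u)))) (at Y)"
    by (rule has_derivative_transform_within_open[OF has_derivative_fst[OF d] open_alpha_pos YU])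
      (simp add: R(1)[symmetric])
  from fun_cong[OF has_derivative_unique[OF this has_derivative_fst[OF has_derivative_ident]]]
  have 1: "fst (lift_pt_deriv J (chart Y) (p' u)) = fst u" by simp
  have bl: "bounded_linear alpha" using linear_alpha linear_conv_bounded_linear by blast
  have "(alpha has_derivative (\<lambda>u. alpha (lift_pt_deriv J (chart Y) (p' u)))) (at Y)"
    by (rule has_derivative_transform_within_open[OF
          bounded_linear.has_derivative[OF bl d] open_alpha_pos YU])
      (simp add: R(2)[symmetric])
  from fun_cong[OF has_derivative_unique[OF this bounded_linear_imp_has_derivative[OF bl]]]
  have 2: "alpha (lift_pt_deriv J (chart Y) (p' u)) = alpha u" by simp
  have "aform J (lift_pt J (chart Y)) (lift_pt_deriv J (chart Y) (p' u)) = 0"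
    by (rule derivative_tangent[OF open_alpha_pos YU R(3) d])
  then have "aform J Y (lift_pt_deriv J (chart Y) (p' u)) = 0"
    using lift_pt_chart[OF YQ] YU by simp
  moreover have "aform J Y u = 0" using u by (simp add: quadric_tangent_def)
  moreover define d where "d = lift_pt_deriv J (chart Y) (p' u) - u"
  ultimately have 3: "aform J Y d = 0" by (simp add: aform.diff_right)
  have "fst d = 0" "alpha d = 0" using 1 2 by (simp_all add: d_def)
  then have d: "d = fst (snd d) *\<^sub>R null_vec"
    by (simp add: null_vec_def prod_eq_iff alpha_def)
  then have "aform J Y d = fst (snd d) * alpha Y"
    using aform_commute[of J Y null_vec] by (metis aform.scaleR_right aform_null_vec real_scaleR_def)
  then have "fst (snd d) = 0" using 3 YU by simp
  then have "d = 0" using d by simp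
  then show ?thesis by (simp add: d_def)
qed

text \<open>
  The chart is an isometry onto \<open>upper J\<close>, so conjugating \<open>g\<close> with it preserves the
  metric.
\<close>

lemma half_isometry_lifts:
  assumes g: "g \<in> Isom_half J"
  shows "local_isometry J {X. alpha X > 0} (\<lambda>X. lift_pt J (g (chart X))) (\<lambda>X. lift_pt J (g (chart X)))"
proof -
  let ?U = "{X :: 'a amb. alpha X > 0}"
  have maps: "g a \<in> half_space" if "a \<in> half_space" for a
    using g that by (auto simp: Isom_half_def dest: Bij_imp_funcset)
  have Cg: "Ck_on k half_space g" for k using g by (simp add: Isom_half_def smooth_on_def)
  have "Ck_on 2 half_space (\<lambda>a. lift_pt J (g a))"
    by (rule Ck_on_compose[OF open_half_space open_half_space maps Ck_on_lift_pt Cg])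
  from Ck_on_compose[OF open_alpha_pos open_half_space _ this Ck_on_chart]
  have C: "Ck_on 2 ?U (\<lambda>X. lift_pt J (g (chart X)))" by (simp add: chart_in_half_space)
  have iso: "aform J (frechet_derivative (\<lambda>X. lift_pt J (g (chart X))) (at Y) u)
      (frechet_derivative (\<lambda>X. lift_pt J (g (chart X))) (at Y) w) = aform J u w"
    if Y: "Y \<in> upper J" and u: "u \<in> quadric_tangent J Y" and w: "w \<in> quadric_tangent J Y" for Y u w
  proof -
    have YU: "Y \<in> ?U" using Y by (simp add: upper_def)
    have p: "(chart has_derivative frechet_derivative chart (at Y)) (at Y)" (is "(_ has_derivative ?p) _")
      by (rule Ck_on_SucD[OF Ck_on_chart YU])
    have a: "chart Y \<in> half_space" using YU by (simp add: chart_in_half_space)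
    let ?g = "frechet_derivative g (at (chart Y))"
    have dg: "(g has_derivative ?g) (at (chart Y))" by (rule Ck_on_SucD[OF Cg a])
    have "((\<lambda>X. g (chart X)) has_derivative (\<lambda>u. ?g (?p u))) (at Y)"
      by (rule has_derivative_compose[OF p dg])
    from has_derivative_compose[OF this lift_pt_has_derivative[OF maps[OF a]]]
    have D: "frechet_derivative (\<lambda>X. lift_pt J (g (chart X))) (at Y) = (\<lambda>u. lift_pt_deriv J (g (chart Y)) (?g (?p u)))"
      by (rule frechet_derivative_at[symmetric])
    have "aform J (lift_pt_deriv J (g (chart Y)) (?g (?p u))) (lift_pt_deriv J (g (chart Y)) (?g (?p w))) =
        half_metric J (g (chart Y)) (?g (?p u)) (?g (?p w))"
      by (rule lift_pt_isometric[OF maps[OF a]])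
    also have "\<dots> = half_metric J (chart Y) (?p u) (?p w)"
      using g a by (simp add: Isom_half_def del: split_paired_All)
    also have "\<dots> = aform J (lift_pt_deriv J (chart Y) (?p u)) (lift_pt_deriv J (chart Y) (?p w))"
      by (rule lift_pt_isometric[OF a, symmetric])
    also have "\<dots> = aform J u w"
      unfolding lift_pt_chart_tangent[OF Y u p] lift_pt_chart_tangent[OF Y w p] ..
    finally show ?thesis unfolding D .
  qed
  then show ?thesis using C open_alpha_pos unfolding local_isometry_def by blast
qed

lemma Isom_half_eq:
  assumes "J \<noteq> {}"
  shows "Isom_half J = G_half J"
proof
  show "Isom_half J \<subseteq> G_half J"
  proof
    fix g assume g: "g \<in> Isom_half J"
    have maps: "g a \<in> half_space" if "a \<in> half_space" for a
      using g that by (auto simp: Isom_half_def dest: Bij_imp_funcset)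
    let ?\<tau> = "\<lambda>X. lift_pt J (g (chart X))"
    have up: "?\<tau> X \<in> upper J" if X: "X \<in> upper J" for X
    proof -
      have "g (chart X) \<in> half_space" using X by (intro maps chart_in_half_space) (simp add: upper_def)
      then show ?thesis
        by (cases "g (chart X)") (simp add: upper_def half_space_iff lift_pt_in_quadric alpha_lift_pt)
    qed
    have loc: "\<exists>U F. X \<in> U \<and> local_isometry J U F ?\<tau>" if X: "X \<in> upper J" for X
    proof (intro exI conjI)
      show "local_isometry J {X. alpha X > 0} ?\<tau> ?\<tau>" by (rule half_isometry_lifts[OF g])
      show "X \<in> {X. alpha X > 0}" using X by (simp add: upper_def)
    qed
    obtain g' where g': "g' \<in> G_half J"
        "\<And>a. a \<in> half_space \<Longrightarrow> lift_pt J (g (chart (lift_pt J a))) = lift_pt J (g' a)"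
      by (rule upper_rigidity[where \<tau> = ?\<tau>, OF assms]) (erule up, erule loc, rule that)
    have chart_lift_pt': "chart (lift_pt J a) = a" if "a \<in> half_space" for a
      using that by (cases a) (simp add: chart_lift_pt half_space_iff)
    have "g a = g' a" if a: "a \<in> half_space" for a
    proof -
      have "chart (lift_pt J (g a)) = chart (lift_pt J (g' a))" using g'(2)[OF a] chart_lift_pt'[OF a] by simp
      then show ?thesis using chart_lift_pt' maps[OF a] G_half_maps[OF g'(1) a] by simp
    qed
    moreover have "g \<in> extensional half_space" "g' \<in> extensional half_space"
      using g G_half_Bij[OF g'(1)] by (auto simp: Isom_half_def Bij_imp_extensional)
    ultimately have "g = g'" by (intro extensionalityI)
    then show "g \<in> G_half J" using g' by simp
  qed
qed (rule G_half_subset_Isom_half)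


section \<open>Isometries of the pseudo-hyperbolic space\<close>

text \<open>
  A class is the set of its two representatives, so a linear map acts on it by taking the
  image.
\<close>

definition proj_map :: "'n::finite set \<Rightarrow> ('n amb \<Rightarrow> 'n amb) \<Rightarrow> 'n amb set \<Rightarrow> 'n amb set" where
  "proj_map J L = restrict (image L) (HH J)"

definition lin_isom :: "'n::finite set \<Rightarrow> ('n amb \<Rightarrow> 'n amb) \<Rightarrow> bool" where
  "lin_isom J L \<longleftrightarrow> linear L \<and> (\<forall>X Y. aform J (L X) (L Y) = aform J X Y)"

lemma lin_isomD:
  assumes "lin_isom J L"
  shows "linear L" and "aform J (L X) (L Y) = aform J X Y"
  using assms by (simp_all add: lin_isom_def del: split_paired_All)

lemma lin_isom_quadric: "lin_isom J L \<Longrightarrow> X \<in> quadric J \<Longrightarrow> L X \<in> quadric J"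
  by (simp add: quadric_def lin_isomD)

lemma lin_isom_bij: "lin_isom J L \<Longrightarrow> bij L"
  by (rule aform_isometry_bij[OF lin_isomD(1) lin_isomD(2)])

lemma lin_isom_inv:
  assumes L: "lin_isom J L"
  shows "lin_isom J (inv_into UNIV L)"
proof -
  note inv = isometry_inv[OF lin_isomD(1)[OF L] lin_isom_bij[OF L], of "aform J",
      OF lin_isomD(2)[OF L]]
  show ?thesis
    unfolding lin_isom_def using inv(1) aform_isometry_polarization[OF inv(1) inv(2)] by blast
qed

lemma lin_isom_comp:
  assumes L: "lin_isom J L" and M: "lin_isom J M"
  shows "lin_isom J (L \<circ> M)"
  unfolding lin_isom_def
  using linear_compose[OF lin_isomD(1)[OF M] lin_isomD(1)[OF L]] lin_isomD(2)[OF L] lin_isomD(2)[OF M]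
  by (simp del: split_paired_All)

lemma proj_map_cls: "lin_isom J L \<Longrightarrow> X \<in> quadric J \<Longrightarrow> proj_map J L (cls X) = cls (L X)"
  using lin_isomD(1)[of J L] by (simp add: proj_map_def cls_in_HH_iff) (simp add: cls_def linear_neg)

lemma is_lift_linear:
  assumes L: "lin_isom J L" and \<phi>: "\<And>X. X \<in> quadric J \<Longrightarrow> \<phi> (cls X) = cls (L X)"
  shows "is_lift J \<phi> UNIV L"
  unfolding is_lift_def smooth_on_def
  using Ck_on_linear[OF lin_isomD(1)[OF L] open_UNIV] lin_isom_quadric[OF L] \<phi> by blast

lemma proj_map_maps:
  assumes "lin_isom J L" and "c \<in> HH J"
  shows "proj_map J L c \<in> HH J"
proof -
  obtain X where "X \<in> quadric J" "c = cls X" using assms(2) by (rule HH_E)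
  then show ?thesis using assms(1) by (simp add: proj_map_cls cls_in_HH_iff lin_isom_quadric)
qed

lemma proj_map_inv:
  assumes L: "lin_isom J L" and c: "c \<in> HH J"
  shows "proj_map J (inv_into UNIV L) (proj_map J L c) = c" and "proj_map J L (proj_map J (inv_into UNIV L) c) = c"
proof -
  obtain X where X: "X \<in> quadric J" "c = cls X" using c by (rule HH_E)
  have "inv_into UNIV L (L X) = X" "L (inv_into UNIV L X) = X"
    using lin_isom_bij[OF L] by (simp_all add: bij_is_inj bij_is_surj surj_f_inv_f)
  then show "proj_map J (inv_into UNIV L) (proj_map J L c) = c" "proj_map J L (proj_map J (inv_into UNIV L) c) = c"
    using X lin_isom_inv[OF L] L by (simp_all add: proj_map_cls lin_isom_quadric)
qed

lemma proj_map_Isom_HH: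
  assumes L: "lin_isom J L"
  shows "proj_map J L \<in> Isom_HH J"
proof -
  note Li = lin_isom_inv[OF L]
  have bij: "bij_betw (proj_map J L) (HH J) (HH J)"
    using proj_map_inv[OF L] proj_map_maps[OF L] proj_map_maps[OF Li]
    by (intro bij_betw_byWitness[where f' = "proj_map J (inv_into UNIV L)"]) auto
  then have Bij: "proj_map J L \<in> Bij (HH J)" by (simp add: Bij_def proj_map_def)
  have lift: "is_lift J (proj_map J L) UNIV L" by (rule is_lift_linear[OF L proj_map_cls[OF L]])
  have "inv_into (HH J) (proj_map J L) (cls X) = cls (inv_into UNIV L X)" if X: "X \<in> quadric J" for X
  proof -
    have "cls X \<in> HH J" using X by (simp add: cls_in_HH_iff)
    then have "inv_into (HH J) (proj_map J L) (cls X) = proj_map J (inv_into UNIV L) (cls X)"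
      using proj_map_inv(2)[OF L] proj_map_maps[OF Li] bij by (metis bij_betw_imp_inj_on inv_into_f_f)
    then show ?thesis using proj_map_cls[OF Li X] by simp
  qed
  then have lift': "is_lift J (inv_into (HH J) (proj_map J L)) UNIV (inv_into UNIV L)"
    by (rule is_lift_linear[OF Li])
  have D: "frechet_derivative L (at Y) = L" for Y
    by (rule frechet_derivative_at[OF linear_imp_has_derivative[OF lin_isomD(1)[OF L]], symmetric])
  have "preserves_metric_HH J (proj_map J L)"
    unfolding preserves_metric_HH_def
  proof
    fix X
    show "\<exists>U F. X \<in> U \<and> is_lift J (proj_map J L) U F \<and>
        (\<forall>Y\<in>U \<inter> quadric J. \<forall>u\<in>quadric_tangent J Y. \<forall>w\<in>quadric_tangent J Y.
          aform J (frechet_derivative F (at Y) u) (frechet_derivative F (at Y) w) = aform J u w)"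
      using lift by (intro exI[of _ UNIV] exI[of _ L]) (simp add: D lin_isomD(2)[OF L])
  qed
  moreover have "smooth_HH J (proj_map J L)" "smooth_HH J (inv_into (HH J) (proj_map J L))"
    unfolding smooth_HH_def using lift lift' by blast+
  ultimately show ?thesis using Bij by (simp add: Isom_HH_def)
qed

lemma proj_map_compose:
  assumes L: "lin_isom J L" and M: "lin_isom J M"
  shows "compose (HH J) (proj_map J L) (proj_map J M) = proj_map J (L \<circ> M)"
proof
  fix c
  show "compose (HH J) (proj_map J L) (proj_map J M) c = proj_map J (L \<circ> M) c"
  proof (cases "c \<in> HH J")
    case True
    then obtain X where X: "X \<in> quadric J" "c = cls X" by (rule HH_E)
    then show ?thesis
      using True lin_isom_comp[OF L M] L M by (simp add: compose_def proj_map_cls lin_isom_quadric)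
  qed (simp add: compose_def proj_map_def)
qed


section \<open>Existence and uniqueness of the induced isometry\<close>

lemma G_half_lift:
  assumes "g \<in> G_half J"
  obtains L where "lin_isom J L" and "\<And>a. a \<in> half_space \<Longrightarrow> L (lift_pt J a) = lift_pt J (g a)"
proof -
  obtain r A v\<^sub>0 where g: "g = sim r A v\<^sub>0" "r > 0" "A \<in> O_group J"
    using assms by (auto simp: G_half_sim)
  have lin: "linear (lift_sim J r A v\<^sub>0)" by (rule linear_lift_sim[OF O_groupD(1)[OF g(3)]])
  have "lin_isom J (lift_sim J r A v\<^sub>0)"
    unfolding lin_isom_def
    using lin aform_isometry_polarization[OF lin aform_lift_sim[OF g(2,3)]] by blast
  then show thesis using that lift_sim_lift_pt[OF g(2,3)] g(1) by blast
qed

lemma lift_pt_in_upper: "a \<in> half_space \<Longrightarrow> lift_pt J a \<in> upper J"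
  by (cases a) (simp add: upper_def lift_pt_in_quadric alpha_lift_pt half_space_iff)

lemma induces_proj_map:
  assumes L: "lin_isom J L" and "\<And>a. a \<in> half_space \<Longrightarrow> L (lift_pt J a) = lift_pt J (g a)"
  shows "induces J g (proj_map J L)"
  unfolding induces_def
proof (intro conjI ballI proj_map_Isom_HH[OF L])
  fix a :: "'a half" assume a: "a \<in> half_space"
  then have "lift_pt J a \<in> quadric J" using lift_pt_in_upper[OF a, of J] by (simp add: upper_def)
  then show "proj_map J L (\<iota> J a) = \<iota> J (g a)"
    using assms(2)[OF a] by (simp add: iota_eq_cls_lift_pt proj_map_cls[OF L])
qed

text \<open>
  The points of the chart are dense: a point of the hyperplane is approached on the
  quadric by increasing its last two coordinates by \<open>t\<close> and correcting the first one by a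
  factor.
\<close>

lemma upper_approach:
  assumes X: "X \<in> quadric J" and a0: "alpha X = 0"
  obtains c where "(c \<longlongrightarrow> X) (at_right (0::real))"
    and "eventually (\<lambda>t. c t \<in> upper J) (at_right 0)"
proof -
  \<comment> \<open>The factor \<open>sqrt (1 + 4 a t)\<close> compensates the change \<open>4 a t\<close> of the last two terms of the form.\<close>
  define a where "a = fst (snd X)"
  have X': "X = (fst X, a, - a)" using a0 by (simp add: a_def alpha_def prod_eq_iff)
  have hX: "h J (fst X) = - 1" using X a0 by (simp add: quadric_def aform_split)
  define c where "c t = (sqrt (1 + 4 * a * t) *\<^sub>R fst X, a + t, - a + t)" for t
  have "(c \<longlongrightarrow> (sqrt (1 + 4 * a * 0) *\<^sub>R fst X, a + 0, - a + 0)) (at_right 0)"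
    unfolding c_def by (intro tendsto_intros)
  then have 1: "(c \<longlongrightarrow> X) (at_right 0)" by (subst X') simp
  have "((\<lambda>t. 1 + 4 * a * t) \<longlongrightarrow> 1 + 4 * a * 0) (at_right 0)" by (intro tendsto_intros)
  then have "eventually (\<lambda>t. 1 + 4 * a * t > 0) (at_right 0)" by (simp add: order_tendstoD(1))
  then have 2: "eventually (\<lambda>t. c t \<in> upper J) (at_right 0)"
    using eventually_at_right_less[of 0]
  proof eventually_elim
    case (elim t)
    have "alpha (c t) = 2 * t" by (simp add: c_def alpha_def)
    moreover have "h J (fst (c t)) = - (1 + 4 * a * t)"
      using elim by (simp add: c_def hform.scaleR_left hform.scaleR_right hX)
    moreover have "fst (snd (c t)) - snd (snd (c t)) = 2 * a" by (simp add: c_def)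
    ultimately show ?case using elim by (simp add: upper_def quadric_def aform_split)
  qed
  show thesis by (rule that[OF 1 2])
qed

text \<open>
  On the hyperplane both maps are determined by continuity. As their lifts are only
  determined up to sign, the limit is taken of \<open>norm (H - F) * norm (H + F)\<close>, which
  vanishes if the lifts agree up to sign.
\<close>

lemma Isom_HH_eqI:
  assumes \<phi>: "\<phi> \<in> Isom_HH J" and \<psi>: "\<psi> \<in> Isom_HH J"
    and eq: "\<And>a. a \<in> half_space \<Longrightarrow> \<phi> (\<iota> J a) = \<psi> (\<iota> J a)"
  shows "\<phi> = \<psi>"
proof -
  have up: "\<phi> (cls X) = \<psi> (cls X)" if X: "X \<in> upper J" for X
  proof -
    have "X \<in> quadric J" "alpha X > 0" using X by (auto simp: upper_def)
    then have "cls X = \<iota> J (chart X)" by (simp add: iota_eq_cls_lift_pt lift_pt_chart)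
    then show ?thesis using eq[OF chart_in_half_space[OF \<open>alpha X > 0\<close>]] by simp
  qed
  have all: "\<phi> (cls X) = \<psi> (cls X)" if X: "X \<in> quadric J" for X
  proof (cases "alpha X = 0")
    case False
    define Y where "Y = (if alpha X > 0 then X else - X)"
    have "Y \<in> upper J" "cls Y = cls X"
      using X False by (auto simp: Y_def upper_def quadric_uminus cls_eq_iff)
    then show ?thesis using up[of Y] by simp
  next
    case True
    obtain U F where UF: "X \<in> U" "is_lift J \<phi> U F"
      using \<phi> X by (auto simp: Isom_HH_def smooth_HH_def simp del: split_paired_All split_paired_Ex)
    obtain V H where VH: "X \<in> V" "is_lift J \<psi> V H"
      using \<psi> X by (auto simp: Isom_HH_def smooth_HH_def simp del: split_paired_All split_paired_Ex)
    obtain c where c: "(c \<longlongrightarrow> X) (at_right (0::real))"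
      and cu: "eventually (\<lambda>t. c t \<in> upper J) (at_right 0)"
      using upper_approach[OF X True] by blast
    have cont: "isCont K X" if "X \<in> W" "is_lift J \<theta> W K" for W K \<theta>
    proof -
      have "Ck_on 0 W K" "open W" using that(2) by (simp_all add: is_lift_def smooth_on_def)
      then show ?thesis using that(1) continuous_on_eq_continuous_at by auto
    qed
    have cF: "((\<lambda>t. F (c t)) \<longlongrightarrow> F X) (at_right 0)"
      by (rule isCont_tendsto_compose[OF cont[OF UF] c])
    have cH: "((\<lambda>t. H (c t)) \<longlongrightarrow> H X) (at_right 0)"
      by (rule isCont_tendsto_compose[OF cont[OF VH] c])
    have cU: "eventually (\<lambda>t. c t \<in> U) (at_right 0)"
      using topological_tendstoD[OF c _ UF(1)] UF(2) by (simp add: is_lift_def)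
    have cV: "eventually (\<lambda>t. c t \<in> V) (at_right 0)"
      using topological_tendstoD[OF c _ VH(1)] VH(2) by (simp add: is_lift_def)
    have "eventually (\<lambda>t. norm (H (c t) - F (c t)) * norm (H (c t) + F (c t)) = 0) (at_right 0)"
      using cu cU cV
    proof eventually_elim
      case (elim t)
      have q: "c t \<in> quadric J" using elim(1) by (simp add: upper_def)
      have "\<phi> (cls (c t)) = cls (F (c t))" "\<psi> (cls (c t)) = cls (H (c t))"
        using UF(2) VH(2) elim q unfolding is_lift_def by blast+
      then have "cls (F (c t)) = cls (H (c t))" using up[OF elim(1)] by simp
      then show ?case by (auto simp: cls_eq_iff)
    qed
    then have "((\<lambda>t. norm (H (c t) - F (c t)) * norm (H (c t) + F (c t))) \<longlongrightarrow> 0) (at_right 0)"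
      by (rule tendsto_eventually)
    moreover have "((\<lambda>t. norm (H (c t) - F (c t)) * norm (H (c t) + F (c t))) \<longlongrightarrow>
        norm (H X - F X) * norm (H X + F X)) (at_right 0)"
      by (intro tendsto_intros cF cH)
    ultimately have "norm (H X - F X) * norm (H X + F X) = 0"
      using tendsto_unique trivial_limit_at_right_real by blast
    then have "H X = F X \<or> H X = - F X" by (auto simp: add_eq_0_iff2)
    moreover have "\<phi> (cls X) = cls (F X)" "\<psi> (cls X) = cls (H X)"
      using UF VH X unfolding is_lift_def by blast+
    ultimately show ?thesis by (auto simp: cls_eq_iff)
  qed
  have "\<phi> \<in> extensional (HH J)" "\<psi> \<in> extensional (HH J)"
    using \<phi> \<psi> by (simp_all add: Isom_HH_def Bij_def)
  then show ?thesis
  proof (rule extensionalityI)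
    fix c assume "c \<in> HH J"
    then obtain X where "X \<in> quadric J" "c = cls X" by (rule HH_E)
    then show "\<phi> c = \<psi> c" using all by simp
  qed
qed

lemma induces_unique:
  "induces J g \<phi> \<Longrightarrow> induces J g \<psi> \<Longrightarrow> \<phi> = \<psi>"
  by (rule Isom_HH_eqI[of _ J]) (simp_all add: induces_def)

lemma induces_ex1:
  assumes "g \<in> G_half J" shows "\<exists>!\<phi>. induces J g \<phi>"
proof -
  obtain L where "lin_isom J L" "\<And>a. a \<in> half_space \<Longrightarrow> L (lift_pt J a) = lift_pt J (g a)"
    using G_half_lift[OF assms] by blast
  then have "induces J g (proj_map J L)" by (rule induces_proj_map)
  then show ?thesis using induces_unique by blast
qed

lemma hat_eqI: "induces J g \<phi> \<Longrightarrow> hat J g = \<phi>"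
  unfolding hat_def by (rule the_equality) (auto intro: induces_unique)

lemma induces_hat: "g \<in> G_half J \<Longrightarrow> induces J g (hat J g)"
  unfolding hat_def by (rule theI'[OF induces_ex1])

lemma hat_compose:
  assumes g: "g \<in> G_half J" and k: "k \<in> G_half J"
  shows "hat J (compose half_space g k) = compose (HH J) (hat J g) (hat J k)"
proof -
  obtain L where L: "lin_isom J L" "\<And>a. a \<in> half_space \<Longrightarrow> L (lift_pt J a) = lift_pt J (g a)"
    using G_half_lift[OF g] by blast
  obtain M where M: "lin_isom J M" "\<And>a. a \<in> half_space \<Longrightarrow> M (lift_pt J a) = lift_pt J (k a)"
    using G_half_lift[OF k] by blast
  have LM: "(L \<circ> M) (lift_pt J a) = lift_pt J (compose half_space g k a)" if a: "a \<in> half_space" for a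
    using L(2)[OF G_half_maps[OF k a]] M(2)[OF a] a by (simp add: compose_def)
  have "hat J (compose half_space g k) = proj_map J (L \<circ> M)"
    by (rule hat_eqI[OF induces_proj_map[OF lin_isom_comp[OF L(1) M(1)] LM]])
  also have "\<dots> = compose (HH J) (proj_map J L) (proj_map J M)"
    by (rule proj_map_compose[OF L(1) M(1), symmetric])
  also have "\<dots> = compose (HH J) (hat J g) (hat J k)"
    using hat_eqI[OF induces_proj_map[OF L]] hat_eqI[OF induces_proj_map[OF M]] by simp
  finally show ?thesis .
qed

lemma hat_mon: "hat J \<in> mon (bij_group_on half_space (G_half J)) (bij_group_on (HH J) (Isom_HH J))"
proof -
  have I: "hat J g \<in> Isom_HH J" if "g \<in> G_half J" for g
    using induces_hat[OF that] by (simp add: induces_def)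
  have B: "hat J g \<in> Bij (HH J)" if "g \<in> G_half J" for g
    using I[OF that] by (simp add: Isom_HH_def)
  have inj: "inj_on (hat J) (G_half J)"
  proof (rule inj_onI)
    fix g k assume g: "g \<in> G_half J" and k: "k \<in> G_half J" and e: "hat J g = hat J k"
    have "g a = k a" if a: "a \<in> half_space" for a
    proof (rule inj_onD[OF iota_inj[of J]])
      show "\<iota> J (g a) = \<iota> J (k a)"
        using induces_hat[OF g] induces_hat[OF k] e a unfolding induces_def by metis
    qed (rule G_half_maps[OF g a] G_half_maps[OF k a])+
    then show "g = k"
      using extensionalityI[OF Bij_imp_extensional[OF G_half_Bij[OF g]]
          Bij_imp_extensional[OF G_half_Bij[OF k]]] by blast
  qed
  have "hat J \<in> hom (bij_group_on half_space (G_half J)) (bij_group_on (HH J) (Isom_HH J))"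
  proof (rule homI)
    fix g assume "g \<in> carrier (bij_group_on half_space (G_half J))"
    then have "g \<in> G_half J" by (simp add: bij_group_on_def)
    from I[OF this] show "hat J g \<in> carrier (bij_group_on (HH J) (Isom_HH J))"
      by (simp add: bij_group_on_def)
  next
    fix g k
    assume "g \<in> carrier (bij_group_on half_space (G_half J))"
      and "k \<in> carrier (bij_group_on half_space (G_half J))"
    then have gk: "g \<in> G_half J" "k \<in> G_half J" by (simp_all add: bij_group_on_def)
    show "hat J (g \<otimes>\<^bsub>bij_group_on half_space (G_half J)\<^esub> k) =
        hat J g \<otimes>\<^bsub>bij_group_on (HH J) (Isom_HH J)\<^esub> hat J k"
      using hat_compose[OF gk] G_half_Bij[OF gk(1)] G_half_Bij[OF gk(2)] B[OF gk(1)] B[OF gk(2)]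
      by (simp add: bij_group_on_def BijGroup_def)
  qed
  then show ?thesis using inj by (simp add: mon_def bij_group_on_def)
qed


section \<open>The stabiliser of the hyperplane\<close>

lemma induced_preserves_complement:
  assumes "induces J g \<phi>" and g: "g \<in> Bij half_space"
  shows "\<phi> ` complement J = complement J"
proof -
  have bij: "bij_betw \<phi> (HH J) (HH J)" using assms(1) by (simp add: induces_def Isom_HH_def Bij_def)
  have sub: "\<iota> J ` half_space \<subseteq> HH J"
  proof
    fix c assume "c \<in> \<iota> J ` half_space"
    then obtain a where "a \<in> half_space" "c = cls (lift_pt J a)" by (auto simp: iota_eq_cls_lift_pt)
    then show "c \<in> HH J" using lift_pt_in_upper[of a J] by (simp add: cls_in_HH_iff upper_def)
  qed
  have "g ` half_space = half_space" using g by (simp add: Bij_def bij_betw_def)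
  moreover have "\<phi> ` \<iota> J ` half_space = \<iota> J ` g ` half_space"
    unfolding image_image by (rule image_cong) (use assms(1) in \<open>simp_all add: induces_def\<close>)
  ultimately have "\<phi> ` \<iota> J ` half_space = \<iota> J ` half_space" by simp
  then show ?thesis
    unfolding complement_def
    using inj_on_image_set_diff[OF bij_betw_imp_inj_on[OF bij] _ sub, of "HH J"]
      bij_betw_imp_surj_on[OF bij] by simp
qed

text \<open>
  An isometry that stabilises the hyperplane also stabilises the set of all other points.
  Choosing the representatives with \<open>alpha > 0\<close> turns it into a map \<open>\<tau>\<close> of \<open>upper J\<close>.
  A given local lift differs from \<open>\<tau>\<close> by a sign that is constant near each point.
\<close>

lemma stabiliser_induced:
  fixes J :: "'n::finite set"
  assumes "J \<noteq> {}" and \<phi>: "\<phi> \<in> Isom_HH J" and stab: "\<phi> ` complement J = complement J"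
  obtains g where "g \<in> G_half J" and "induces J g \<phi>"
proof -
  have bij: "bij_betw \<phi> (HH J) (HH J)" using \<phi> by (simp add: Isom_HH_def Bij_def)
  have compl_HH: "complement J \<subseteq> HH J" by (auto simp: complement_def)
  have "\<exists>Z. Z \<in> upper J \<and> \<phi> (cls X) = cls Z" if X: "X \<in> upper J" for X
  proof -
    have Xq: "X \<in> quadric J" "cls X \<in> HH J" using X by (auto simp: upper_def cls_in_HH_iff)
    have "cls X \<notin> complement J" using X cls_in_complement_iff[OF Xq(1)] by (simp add: upper_def)
    then have n: "\<phi> (cls X) \<notin> complement J"
      using stab inj_on_image_mem_iff[OF bij_betw_imp_inj_on[OF bij] Xq(2) compl_HH] by metis
    have "\<phi> (cls X) \<in> HH J" by (rule bij_betwE[OF bij, rule_format, OF Xq(2)])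
    then obtain Y where Y: "Y \<in> quadric J" "\<phi> (cls X) = cls Y" by (rule HH_E)
    then have "alpha Y \<noteq> 0" using n cls_in_complement_iff by metis
    then have "(if alpha Y > 0 then Y else - Y) \<in> upper J"
      and "cls (if alpha Y > 0 then Y else - Y) = cls Y"
      using Y(1) by (auto simp: upper_def quadric_uminus cls_eq_iff)
    then show ?thesis using Y(2) by metis
  qed
  then obtain \<tau> where \<tau>: "\<And>X. X \<in> upper J \<Longrightarrow> \<tau> X \<in> upper J"
    and \<phi>\<tau>: "\<And>X. X \<in> upper J \<Longrightarrow> \<phi> (cls X) = cls (\<tau> X)"
    by metis
  have loc: "\<exists>V H. X \<in> V \<and> local_isometry J V H \<tau>" if X: "X \<in> upper J" for X
  proof -
    have Xq: "X \<in> quadric J" using X by (simp add: upper_def)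
    have "preserves_metric_HH J \<phi>" using \<phi> by (simp add: Isom_HH_def)
    from bspec[OF this[unfolded preserves_metric_HH_def] Xq]
    obtain U F where U: "X \<in> U" and F: "is_lift J \<phi> U F" and iso:
      "\<forall>Y\<in>U \<inter> quadric J. \<forall>u\<in>quadric_tangent J Y. \<forall>w\<in>quadric_tangent J Y.
        aform J (frechet_derivative F (at Y) u) (frechet_derivative F (at Y) w) = aform J u w"
      by (elim exE conjE)
    have oU: "open U" and CF: "Ck_on k U F" for k using F by (auto simp: is_lift_def smooth_on_def)
    have lift: "F Y \<in> quadric J" "cls (\<tau> Y) = cls (F Y)" if "Y \<in> U" "Y \<in> upper J" for Y
      using F that \<phi>\<tau>[OF that(2)] unfolding is_lift_def upper_def by auto
    define e :: real where "e = (if alpha (F X) > 0 then 1 else - 1)"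
    have ee: "e * e = 1" by (simp add: e_def)
    define V where "V = U \<inter> (\<lambda>Y. e * alpha (F Y)) -` {0<..}"
    have "Ck_on 0 U (\<lambda>Y. e * alpha (F Y))"
      by (rule Ck_on_linear_comp[OF _ oU CF], rule linearI) (simp_all add: algebra_simps)
    then have oV: "open V"
      unfolding V_def by (intro continuous_open_preimage oU) auto
    have pos: "\<tau> Y = e *\<^sub>R F Y" if "Y \<in> V" "Y \<in> upper J" for Y
    proof -
      have "Y \<in> U" "e * alpha (F Y) > 0" using that(1) by (auto simp: V_def)
      moreover have "F Y = \<tau> Y \<or> F Y = - \<tau> Y"
        using lift(2)[OF \<open>Y \<in> U\<close> that(2)] by (auto simp: cls_eq_iff)
      moreover have "alpha (\<tau> Y) > 0" using \<tau>[OF that(2)] by (simp add: upper_def)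
      ultimately show ?thesis by (auto simp: e_def split: if_splits)
    qed
    have "alpha (F X) \<noteq> 0"
    proof -
      have "F X = \<tau> X \<or> F X = - \<tau> X" using lift(2)[OF U X] by (auto simp: cls_eq_iff)
      then show ?thesis using \<tau>[OF X] by (auto simp: upper_def)
    qed
    then have XV: "X \<in> V" using U by (auto simp: V_def e_def)
    have CV: "Ck_on 2 V (\<lambda>Y. e *\<^sub>R F Y)"
      by (rule Ck_on_linear_comp[OF _ oV Ck_on_subset[OF CF]], rule linearI)
        (auto simp: V_def algebra_simps)
    have "aform J (frechet_derivative (\<lambda>Y. e *\<^sub>R F Y) (at Y) u)
        (frechet_derivative (\<lambda>Y. e *\<^sub>R F Y) (at Y) w) = aform J u w"
      if Y: "Y \<in> V" "Y \<in> upper J" and uw: "u \<in> quadric_tangent J Y" "w \<in> quadric_tangent J Y"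
      for Y u w
    proof -
      have YU: "Y \<in> U" "Y \<in> U \<inter> quadric J" using Y by (auto simp: V_def upper_def)
      have "((\<lambda>Y. e *\<^sub>R F Y) has_derivative (\<lambda>u. e *\<^sub>R frechet_derivative F (at Y) u)) (at Y)"
        by (rule has_derivative_scaleR_right[OF Ck_on_SucD[OF CF YU(1)]])
      note D = frechet_derivative_at[OF this, symmetric]
      show ?thesis unfolding D aform.scaleR_left aform.scaleR_right
        using iso[rule_format, OF YU(2) uw] ee by (simp add: mult.assoc[symmetric])
    qed
    then have "local_isometry J V (\<lambda>Y. e *\<^sub>R F Y) \<tau>"
      unfolding local_isometry_def using oV CV pos by auto
    then show ?thesis using XV by blast
  qed
  obtain g where g: "g \<in> G_half J" "\<And>a. a \<in> half_space \<Longrightarrow> \<tau> (lift_pt J a) = lift_pt J (g a)"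
    using upper_rigidity[OF assms(1) \<tau> loc] by blast
  have "\<phi> (\<iota> J a) = \<iota> J (g a)" if "a \<in> half_space" for a
    using \<phi>\<tau>[OF lift_pt_in_upper[OF that]] g(2)[OF that] by (simp add: iota_eq_cls_lift_pt)
  then have "induces J g \<phi>" using \<phi> unfolding induces_def by blast
  then show thesis using that g(1) by blast
qed

lemma hat_image:
  assumes "J \<noteq> {}"
  shows "hat J ` G_half J = {\<phi> \<in> Isom_HH J. \<phi> ` complement J = complement J}"
proof (intro equalityI subsetI)
  fix \<phi> assume "\<phi> \<in> hat J ` G_half J"
  then obtain g where g: "g \<in> G_half J" "\<phi> = hat J g" by blast
  then have "induces J g \<phi>" using induces_hat by blast
  then show "\<phi> \<in> {\<phi> \<in> Isom_HH J. \<phi> ` complement J = complement J}"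
    using induced_preserves_complement[OF _ G_half_Bij[OF g(1)]] by (simp add: induces_def)
next
  fix \<phi> assume "\<phi> \<in> {\<phi> \<in> Isom_HH J. \<phi> ` complement J = complement J}"
  then have \<phi>: "\<phi> \<in> Isom_HH J" "\<phi> ` complement J = complement J" by auto
  obtain g where "g \<in> G_half J" "induces J g \<phi>" using stabiliser_induced[OF assms \<phi>] by blast
  then show "\<phi> \<in> hat J ` G_half J" using hat_eqI by blast
qed


section \<open>The geometry of the hyperplane\<close>

lemma complement_is_hyperplane: "is_hyperplane J (complement J)"
  unfolding is_hyperplane_def
proof (intro exI conjI)
  have "{X :: 'a amb. alpha X = 0} = {X. (0, 1, 1) \<bullet> X = 0}"
    by (simp add: alpha_def inner_prod_def)
  moreover have "((0, 1, 1) :: 'a amb) \<noteq> 0" by (simp add: zero_prod_def)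
  ultimately have "dim {X :: 'a amb. alpha X = 0} = DIM('a amb) - 1"
    by (metis dim_hyperplane)
  then show "dim {X :: 'a amb. alpha X = 0} + 1 = DIM('a amb)"
    using DIM_positive[where 'a = "'a amb"] by linarith
  show "subspace {X :: 'a amb. alpha X = 0}" by (simp add: subspace_def)
  show "complement J = cls ` (quadric J \<inter> {X. alpha X = 0})" by (rule complement_eq)
qed

lemma velocity_in_kernel:
  assumes "u \<in> velocities (quadric J \<inter> {X. alpha X = 0}) X"
  shows "alpha u = 0"
proof -
  obtain \<sigma> e where e: "e > 0" "\<And>t. \<bar>t\<bar> < e \<Longrightarrow> \<sigma> t \<in> quadric J \<inter> {X. alpha X = 0}"
    and d: "(\<sigma> has_vector_derivative u) (at (0::real))"
    using assms unfolding velocities_def by blast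
  have bl: "bounded_linear alpha" using linear_alpha linear_conv_bounded_linear by blast
  have 1: "((\<lambda>t. alpha (\<sigma> t)) has_vector_derivative alpha u) (at 0)"
    by (rule bounded_linear.has_vector_derivative[OF bl d])
  have "((\<lambda>t. alpha (\<sigma> t)) has_vector_derivative 0) (at 0)"
  proof (rule has_vector_derivative_transform_within_open[OF has_vector_derivative_const])
    show "open {- e<..<e}" "0 \<in> {- e<..<e}" using e(1) by auto
    show "0 = alpha (\<sigma> t)" if "t \<in> {- e<..<e}" for t using e(2)[of t] that by auto
  qed
  from vector_derivative_unique_at[OF 1 this] show ?thesis .
qed

text \<open>
  The degenerate direction is \<open>null_vec\<close>: it is orthogonal to the whole kernel of \<open>alpha\<close>,
  and the lines in its direction stay in the quadric.
\<close>

lemma complement_degenerate: "is_degenerate J (complement J)"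
  unfolding is_degenerate_def lift_set_complement
proof (intro ballI bexI conjI)
  fix X assume X: "X \<in> quadric J \<inter> {X. alpha X = 0}"
  show "null_vec \<noteq> 0" by (simp add: null_vec_def zero_prod_def)
  show "aform J null_vec u = 0" if "u \<in> velocities (quadric J \<inter> {X. alpha X = 0}) X" for u
    using velocity_in_kernel[OF that] by (simp add: aform_null_vec)
  have "X + t *\<^sub>R null_vec \<in> quadric J \<inter> {X. alpha X = 0}" for t
    using X aform_commute[of J X null_vec]
    by (simp add: quadric_def aform.add_left aform.add_right aform.scaleR_left aform.scaleR_right
        aform_null_vec)
  moreover have "((\<lambda>t. X + t *\<^sub>R null_vec) has_vector_derivative null_vec) (at 0)"
    by (auto intro!: derivative_eq_intros)
  ultimately show "null_vec \<in> velocities (quadric J \<inter> {X. alpha X = 0}) X"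
    unfolding velocities_def
    by (intro CollectI exI[of _ "\<lambda>t. X + t *\<^sub>R null_vec"] exI[of _ 1]) auto
qed

text \<open>
  With a complex square root \<open>m\<close> of \<open>\<mu>\<close> the equation factors into two of first order,
  each of which is solved by an exponential. This treats all signs of \<open>\<mu>\<close> at once.
\<close>

lemma linear_ode_zero:
  fixes f g :: "real \<Rightarrow> real"
  assumes S: "convex S" "x0 \<in> S" and x: "x \<in> S" and zero: "f x0 = 0" "g x0 = 0"
    and f: "\<And>t. t \<in> S \<Longrightarrow> (f has_vector_derivative g t) (at t)"
    and g: "\<And>t. t \<in> S \<Longrightarrow> (g has_vector_derivative \<mu> * f t) (at t)"
  shows "f x = 0"
proof -
  define m where "m = csqrt (complex_of_real \<mu>)"
  have m: "m * m = complex_of_real \<mu>" by (simp add: m_def power2_eq_square[symmetric])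
  have exp: "((\<lambda>t. exp (c * complex_of_real t)) has_vector_derivative c * exp (c * complex_of_real t))
      (at t within S)" for c t
  proof -
    have "((\<lambda>z. exp (c * z)) has_field_derivative c * exp (c * complex_of_real t)) (at (of_real t))"
      by (auto intro!: derivative_eq_intros)
    from has_vector_derivative_real_field[OF this] show ?thesis
      by (rule has_vector_derivative_at_within)
  qed
  have fc: "((\<lambda>t. complex_of_real (f t)) has_vector_derivative of_real (g t)) (at t within S)"
    if "t \<in> S" for t
    by (rule has_vector_derivative_at_within,
        rule bounded_linear.has_vector_derivative[OF bounded_linear_of_real f[OF that]])
  have gc: "((\<lambda>t. complex_of_real (g t)) has_vector_derivative of_real (\<mu> * f t)) (at t within S)"
    if "t \<in> S" for t
    by (rule has_vector_derivative_at_within,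
        rule bounded_linear.has_vector_derivative[OF bounded_linear_of_real g[OF that]])
  have P: "((\<lambda>t. (of_real (g t) - m * of_real (f t)) * exp (m * of_real t)) has_vector_derivative 0)
      (at t within S)" if t: "t \<in> S" for t
  proof -
    have "((\<lambda>t. (of_real (g t) - m * of_real (f t)) * exp (m * of_real t)) has_vector_derivative
        (of_real (g t) - m * of_real (f t)) * (m * exp (m * of_real t)) +
        (of_real (\<mu> * f t) - m * of_real (g t)) * exp (m * of_real t)) (at t within S)"
      by (intro has_vector_derivative_mult has_vector_derivative_diff
          has_vector_derivative_mult_right fc[OF t] gc[OF t] exp)
    moreover have "(of_real (g t) - m * of_real (f t)) * (m * exp (m * of_real t)) +
        (of_real (\<mu> * f t) - m * of_real (g t)) * exp (m * of_real t) = 0"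
      by (simp add: m[symmetric] algebra_simps)
    ultimately show ?thesis by simp
  qed
  obtain c where c: "\<And>t. t \<in> S \<Longrightarrow> (of_real (g t) - m * of_real (f t)) * exp (m * of_real t) = c"
    using has_vector_derivative_zero_constant[OF S(1) P] by blast
  have gf: "complex_of_real (g t) = m * of_real (f t)" if "t \<in> S" for t
    using c[OF that] c[OF S(2)] zero by simp
  have Q: "((\<lambda>t. of_real (f t) * exp (- m * of_real t)) has_vector_derivative 0) (at t within S)"
    if t: "t \<in> S" for t
  proof -
    have "((\<lambda>t. of_real (f t) * exp (- m * of_real t)) has_vector_derivative
        of_real (f t) * (- m * exp (- m * of_real t)) + of_real (g t) * exp (- m * of_real t))
        (at t within S)"
      by (intro has_vector_derivative_mult fc[OF t] exp)
    then show ?thesis by (simp add: gf[OF t])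
  qed
  obtain d where d: "\<And>t. t \<in> S \<Longrightarrow> of_real (f t) * exp (- m * of_real t) = d"
    using has_vector_derivative_zero_constant[OF S(1) Q] by blast
  show ?thesis using d[OF x] d[OF S(2)] zero by simp
qed

text \<open>
  The acceleration is normal to the quadric, hence a multiple \<open>\<mu>\<close> of the position, and
  differentiating \<open>aform J c c = -1\<close> twice identifies \<open>\<mu>\<close> as \<open>aform J c' c'\<close>, which is
  constant. So \<open>alpha \<circ> c\<close> solves \<open>f'' = \<mu> * f\<close> with zero initial values.
\<close>

lemma geodesic_in_kernel:
  assumes c: "geodesic_on J {a<..<b} c" and ab: "a < 0" "0 < b" and t: "t \<in> {a<..<b}"
    and zero: "alpha (c 0) = 0" "alpha (vector_derivative c (at 0)) = 0"
  shows "alpha (c t) = 0"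
proof -
  let ?I = "{a<..<b}"
  obtain c' c'' where quad: "\<And>t. t \<in> ?I \<Longrightarrow> c t \<in> quadric J"
    and c': "\<And>t. t \<in> ?I \<Longrightarrow> (c has_vector_derivative c' t) (at t)"
    and c'': "\<And>t. t \<in> ?I \<Longrightarrow> (c' has_vector_derivative c'' t) (at t)"
    and normal: "\<And>t u. t \<in> ?I \<Longrightarrow> u \<in> quadric_tangent J (c t) \<Longrightarrow> aform J (c'' t) u = 0"
    using c unfolding geodesic_on_def by blast
  have cc: "aform J (c t) (c t) = - 1" if "t \<in> ?I" for t using quad[OF that] by (simp add: quadric_def)
  have const0: "d = 0" if "((\<lambda>s. k) has_vector_derivative d) (at t)" for k d :: real and t
    using vector_derivative_unique_at[OF that has_vector_derivative_const] .
  have tangent: "aform J (c t) (c' t) = 0" if t: "t \<in> ?I" for t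
  proof -
    have "((\<lambda>s. aform J (c s) (c s)) has_vector_derivative
        aform J (c t) (c' t) + aform J (c' t) (c t)) (at t)"
      by (rule aform.has_vector_derivative[OF c'[OF t] c'[OF t]])
    then have "((\<lambda>s. - 1) has_vector_derivative aform J (c t) (c' t) + aform J (c' t) (c t)) (at t)"
      by (rule has_vector_derivative_transform_within_open[OF _ open_greaterThanLessThan t]) (rule cc)
    from const0[OF this] show ?thesis using aform_commute[of J "c t" "c' t"] by simp
  qed
  have acc: "aform J (c'' t) (c t) = - aform J (c' t) (c' t)" if t: "t \<in> ?I" for t
  proof -
    have "((\<lambda>s. aform J (c s) (c' s)) has_vector_derivative
        aform J (c t) (c'' t) + aform J (c' t) (c' t)) (at t)"
      by (rule aform.has_vector_derivative[OF c'[OF t] c''[OF t]])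
    then have "((\<lambda>s. 0) has_vector_derivative aform J (c t) (c'' t) + aform J (c' t) (c' t)) (at t)"
      by (rule has_vector_derivative_transform_within_open[OF _ open_greaterThanLessThan t])
        (rule tangent)
    from const0[OF this] show ?thesis using aform_commute[of J "c t" "c'' t"] by simp
  qed
  have speed: "\<exists>\<mu>. \<forall>t\<in>?I. aform J (c' t) (c' t) = \<mu>"
  proof -
    have "((\<lambda>s. aform J (c' s) (c' s)) has_vector_derivative 0) (at t within ?I)" if t: "t \<in> ?I" for t
    proof -
      have "((\<lambda>s. aform J (c' s) (c' s)) has_vector_derivative
          aform J (c' t) (c'' t) + aform J (c'' t) (c' t)) (at t)"
        by (rule aform.has_vector_derivative[OF c''[OF t] c''[OF t]])
      moreover have "aform J (c'' t) (c' t) = 0"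
        using normal[OF t] tangent[OF t] by (simp add: quadric_tangent_def)
      ultimately show ?thesis
        using aform_commute[of J "c' t" "c'' t"] has_vector_derivative_at_within by fastforce
    qed
    from has_vector_derivative_zero_constant[OF _ this] show ?thesis
      by (metis convex_real_interval(8))
  qed
  then obtain \<mu> where \<mu>: "\<And>t. t \<in> ?I \<Longrightarrow> aform J (c' t) (c' t) = \<mu>" by blast
  have alpha_acc: "alpha (c'' t) = \<mu> * alpha (c t)" if t: "t \<in> ?I" for t
  proof -
    \<comment> \<open>The orthogonal projection of \<open>null_vec\<close> to the tangent space at \<open>c t\<close>.\<close>
    let ?u = "null_vec + alpha (c t) *\<^sub>R c t"
    have "aform J (c t) null_vec = alpha (c t)" using aform_commute aform_null_vec by metis
    then have "?u \<in> quadric_tangent J (c t)"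
      by (simp add: quadric_tangent_def aform.add_right aform.scaleR_right cc[OF t])
    from normal[OF t this] have "aform J (c'' t) null_vec + alpha (c t) * aform J (c'' t) (c t) = 0"
      by (simp add: aform.add_right aform.scaleR_right)
    moreover have "aform J (c'' t) null_vec = alpha (c'' t)"
      using aform_commute aform_null_vec by metis
    ultimately show ?thesis by (simp add: acc[OF t] \<mu>[OF t])
  qed
  have bl: "bounded_linear alpha" using linear_alpha linear_conv_bounded_linear by blast
  have 0: "0 \<in> ?I" using ab by simp
  have "alpha (c' 0) = 0" using zero(2) vector_derivative_at[OF c'[OF 0]] by simp
  show ?thesis
  proof (rule linear_ode_zero[where S = ?I and ?x0.0 = 0 and f = "\<lambda>t. alpha (c t)"
        and g = "\<lambda>t. alpha (c' t)" and \<mu> = \<mu>])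
    show "((\<lambda>t. alpha (c t)) has_vector_derivative alpha (c' t)) (at t)" if "t \<in> ?I" for t
      by (rule bounded_linear.has_vector_derivative[OF bl c'[OF that]])
    show "((\<lambda>t. alpha (c' t)) has_vector_derivative \<mu> * alpha (c t)) (at t)" if "t \<in> ?I" for t
      using bounded_linear.has_vector_derivative[OF bl c''[OF that]] by (simp add: alpha_acc[OF that])
  qed (use 0 t zero(1) \<open>alpha (c' 0) = 0\<close> in \<open>simp_all add: convex_real_interval\<close>)
qed

lemma complement_totally_geodesic: "totally_geodesic J (complement J)"
  unfolding totally_geodesic_def lift_set_complement
proof (intro allI impI ballI)
  fix c a b t
  assume ab: "a < 0" "0 < b" and c: "geodesic_on J {a<..<b} c"
    and c0: "c 0 \<in> quadric J \<inter> {X. alpha X = 0}"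
    and v: "vector_derivative c (at 0) \<in> velocities (quadric J \<inter> {X. alpha X = 0}) (c 0)"
    and t: "t \<in> {a<..<b}"
  have "alpha (c t) = 0"
    by (rule geodesic_in_kernel[OF c ab t]) (use c0 velocity_in_kernel[OF v] in simp_all)
  moreover have "c t \<in> quadric J" using c t unfolding geodesic_on_def by blast
  ultimately show "c t \<in> quadric J \<inter> {X. alpha X = 0}" by simp
qed


theorem theorem7p1:
  fixes p q :: nat and J :: "'n::finite set"
  assumes "p \<ge> 1" and "q \<ge> 1"
    and "card (- J) = p - 1" and "card J = q"
  shows "subgroup (G_half J) (BijGroup half_space) \<and>
    G_half J = Isom_half J \<and>
    is_hyperplane J (complement J) \<and>
    totally_geodesic J (complement J) \<and>
    is_degenerate J (complement J) \<and>
    (\<forall>g\<in>G_half J. \<exists>!\<phi>. induces J g \<phi>) \<and>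
    hat J \<in> mon (bij_group_on half_space (G_half J)) (bij_group_on (HH J) (Isom_HH J)) \<and>
    hat J ` G_half J = {\<phi> \<in> Isom_HH J. \<phi> ` complement J = complement J}"
proof -
  have J: "J \<noteq> {}" using assms(2,4) by auto
  show ?thesis
    using subgroup_G_half Isom_half_eq[OF J] complement_is_hyperplane complement_totally_geodesic
      complement_degenerate induces_ex1 hat_mon hat_image[OF J]
    by (intro conjI ballI) simp_all
qed

end
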